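(* Let $\mathbb{F}$ be an algebraically closed field of characteristic zero. Let $\mathcal{H}(\underline{\ell},\Gamma)$ and $\mathcal{H}(\underline{\ell}',\Gamma')$ be two Hamiltonian Lie algebras over $\mathbb{F}$, with underlying Poisson algebras $(\mathcal{A},\cdot,[\cdot,\cdot])$ and $(\mathcal{A}',\cdot,[\cdot,\cdot])$ respectively. Then $\mathcal{H}(\underline{\ell},\Gamma)$ and $\mathcal{H}(\underline{\ell}',\Gamma')$ are isomorphic as Lie algebras if and only if $(\mathcal{A},\cdot,[\cdot,\cdot])$ and $(\mathcal{A}',\cdot,[\cdot,\cdot])$ are isomorphic as Poisson algebras, i.e. there is an $\mathbb{F}$-linear bijection $\mathcal{A}\to\mathcal{A}'$ preserving both the associative product and the Lie bracket.
   Context: Construction of the Hamiltonian Lie algebra $\mathcal{H}(\underline{\ell},\Gamma)$ over a field $\mathbb{F}$ of characteristic zero. Here $\mathbb{N}=\{0,1,2,\dots\}$ and $\overline{m,n}=\{m,m+1,\dots,n\}$ (empty if $m>n$). Index sets. Let $\underline{\ell}=(\ell_1,\dots,\ell_7)\in\mathbb{N}^7\setminus\{0\}$, $\iota_0=0$, $\iota_i=\ell_1+\cdots+\ell_i$. Put $I_{i,j}=\overline{\iota_{i-1}+1,\iota_j}$ for $1\le i\le j\le 7$, $I_i=I_{i,i}$, $I=I_{1,7}$, $J=\overline{1,2\iota_7}$. For $p\in J$ let $\bar p=p+\iota_7$ if $p\le\iota_7$ and $\bar p=p-\iota_7$ otherwise; for $K\subset J$ put $\bar K=\{\bar p\mid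 p\in K\}$. Put $J_i=I_i\cup\bar I_i$, $J_{i,j}=I_{i,j}\cup\bar I_{i,j}$. Vectors. Elements of $\mathbb{F}^{2\iota_7}$ are written $\alpha=(\alpha_1,\alpha_{\bar 1},\dots,\alpha_{\iota_7},\alpha_{\bar\iota_7})$; $\varepsilon_p$ ($p\in J$) is the standard basis vector with $p$-th coordinate $1$; for $K\subset J$, $\alpha_K$ is the vector of the coordinates $\alpha_p$, $p\in K$. Define $\sigma_p=\varepsilon_p+\varepsilon_{\bar p}$ for $p\in I_1\cup I_{3,4}$, $\sigma_p=\varepsilon_p$ for $p\in I_2$, $\sigma_p=0$ for $p\in I_{5,7}$, and $\sigma_{\bar p}=\sigma_p$. The data $\Gamma$ and $\mathcal{J}$. $\Gamma$ is an additive subgroup of $\mathbb{F}^{2\iota_7}$ such that $\alpha_{\bar I_{5,6}\cup J_7}=0$ for all $\alpha\in\Gamma$, and $\sigma_p\in\Gamma$, $\varepsilon_q\in\Gamma$, $\mathbb{F}\varepsilon_r\cap\Gamma\neq\{0\}$ for all $p\in I_{1,4}$, $q\in I_{5,6}$, $r\in J_{1,4}$. Let $\mathcal{J}=\{\underline{i}\in\mathbb{N}^{2\iota_7}\mid \underline{i}_{J_1\cup\bar I_{2,3}\cup I_5}=0\}$. The algebra. $\mathcal{A}=\mathbb{F}[\Gamma\times\mathcal{J}]$ is the commutative semigroup algebra with basis $x^{\alpha,\underline{i}}$, $(\alpha,\underline{i})\in\Gamma\times\mathcal{J}$, and product $x^{\alpha,\underline{i}}\cdot x^{\beta,\underline{j}}=x^{\alpha+\beta,\underline{i}+\underline{j}}$.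 Write $x^\alpha=x^{\alpha,0}$. For $p\in J$ define derivations $\partial^*_p(x^{\alpha,\underline{i}})=\alpha_p x^{\alpha,\underline{i}}$, $\partial_{t_p}(x^{\alpha,\underline{i}})=i_p x^{\alpha,\underline{i}-\varepsilon_p}$ (interpreting $x^{\alpha,\underline{i}}=0$ if $(\alpha,\underline{i})\notin\Gamma\times\mathcal{J}$), $\partial_p=\partial^*_p+\partial_{t_p}$. The Lie bracket on $\mathcal{A}$ is $$[u,v]=\sum_{p\in I}x^{\sigma_p}\bigl(\partial_p(u)\partial_{\bar p}(v)-\partial_{\bar p}(u)\partial_p(v)\bigr).$$ The Lie algebra $(\mathcal{A},[\cdot,\cdot])$ is the Hamiltonian Lie algebra $\mathcal{H}(\underline{\ell},\Gamma)$, and $(\mathcal{A},\cdot,[\cdot,\cdot])$ is its corresponding Poisson algebra (the bracket satisfies $[u,v\cdot w]=[u,v]\cdot w+v\cdot[u,w]$). The primed objects are those of the same construction for $(\underline{\ell}',\Gamma')$, over the same field. *)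

theory Defs
  imports
    "HOL-Library.Poly_Mapping"
    "HOL-Library.Product_Plus"
    "HOL-Computational_Algebra.Polynomial"
begin

section \<open>Index sets\<close>

text \<open>
  A tuple \<open>(l\<^sub>1, \<dots>, l\<^sub>7)\<close> is a function \<open>l :: nat \<Rightarrow> nat\<close> of which only the values at
  \<open>1, \<dots>, 7\<close> are ever used.
\<close>

definition iota :: "(nat \<Rightarrow> nat) \<Rightarrow> nat \<Rightarrow> nat" where
  "iota l i = (\<Sum>k = 1..i. l k)"

definition idx_I :: "(nat \<Rightarrow> nat) \<Rightarrow> nat \<Rightarrow> nat \<Rightarrow> nat set" where
  "idx_I l i j = {iota l (i - 1) + 1 .. iota l j}"

definition bar :: "(nat \<Rightarrow> nat) \<Rightarrow> nat \<Rightarrow> nat" where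
  "bar l p = (if p \<le> iota l 7 then p + iota l 7 else p - iota l 7)"

definition idx_J :: "(nat \<Rightarrow> nat) \<Rightarrow> nat \<Rightarrow> nat \<Rightarrow> nat set" where
  "idx_J l i j = idx_I l i j \<union> bar l ` idx_I l i j"

definition idx_all :: "(nat \<Rightarrow> nat) \<Rightarrow> nat set" where
  "idx_all l = {1 .. 2 * iota l 7}"


section \<open>Vectors, the group, and the multi-indices\<close>

text \<open>
  Vectors in \<open>F^(2 \<iota>\<^sub>7)\<close> and multi-indices in \<open>N^(2 \<iota>\<^sub>7)\<close> are finitely supported functions on
  \<open>nat\<close> whose support lies in \<open>idx_all l\<close>; the \<open>p\<close>-th standard basis vector is
  \<open>Poly_Mapping.single p 1\<close>.
\<close>

type_synonym 'a vec = "nat \<Rightarrow>\<^sub>0 'a"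
type_synonym mindex = "nat \<Rightarrow>\<^sub>0 nat"

definition vec_space :: "(nat \<Rightarrow> nat) \<Rightarrow> 'a::zero vec set" where
  "vec_space l = {\<alpha>. Poly_Mapping.keys \<alpha> \<subseteq> idx_all l}"

definition sigma :: "(nat \<Rightarrow> nat) \<Rightarrow> nat \<Rightarrow> 'a::field vec" where
  "sigma l p =
    (if p \<in> idx_J l 1 1 \<union> idx_J l 3 4
       then Poly_Mapping.single p 1 + Poly_Mapping.single (bar l p) 1
     else if p \<in> idx_I l 2 2 then Poly_Mapping.single p 1
     else if p \<in> bar l ` idx_I l 2 2 then Poly_Mapping.single (bar l p) 1
     else 0)"

definition additive_subgroup_of :: "'g::group_add set \<Rightarrow> 'g set \<Rightarrow> bool" where
  "additive_subgroup_of H G \<longleftrightarrow>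
    H \<subseteq> G \<and> 0 \<in> H \<and> (\<forall>a\<in>H. \<forall>b\<in>H. a + b \<in> H) \<and> (\<forall>a\<in>H. - a \<in> H)"

definition admissible_group :: "(nat \<Rightarrow> nat) \<Rightarrow> 'a::field vec set \<Rightarrow> bool" where
  "admissible_group l \<Gamma> \<longleftrightarrow>
    additive_subgroup_of \<Gamma> (vec_space l) \<and>
    (\<forall>\<alpha>\<in>\<Gamma>. \<forall>p \<in> bar l ` idx_I l 5 6 \<union> idx_J l 7 7. Poly_Mapping.lookup \<alpha> p = 0) \<and>
    (\<forall>p \<in> idx_I l 1 4. sigma l p \<in> \<Gamma>) \<and>
    (\<forall>q \<in> idx_I l 5 6. Poly_Mapping.single q 1 \<in> \<Gamma>) \<and>
    (\<forall>r \<in> idx_J l 1 4. {Poly_Mapping.single r c |c. True} \<inter> \<Gamma> \<noteq> {0})"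

definition hamiltonian_datum :: "(nat \<Rightarrow> nat) \<Rightarrow> 'a::field vec set \<Rightarrow> bool" where
  "hamiltonian_datum l \<Gamma> \<longleftrightarrow> (\<exists>i\<in>{1..7}. l i \<noteq> 0) \<and> admissible_group l \<Gamma>"

definition mindices :: "(nat \<Rightarrow> nat) \<Rightarrow> mindex set" where
  "mindices l =
    {i. Poly_Mapping.keys i \<subseteq> idx_all l \<and>
        (\<forall>p \<in> idx_J l 1 1 \<union> bar l ` idx_I l 2 3 \<union> idx_I l 5 5. Poly_Mapping.lookup i p = 0)}"


section \<open>The Poisson algebra\<close>

text \<open>
  The semigroup algebra of \<open>\<Gamma> \<times> mindices l\<close> is the set of elements of the monoid algebra of all pairs
  \<open>(\<alpha>, i)\<close> whose support lies in \<open>\<Gamma> \<times> mindices l\<close>. The associative product is the convolution product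
  \<open>*\<close> on \<open>poly_mapping\<close>, and the basis element \<open>x^(\<alpha>,i)\<close> is
  \<open>Poly_Mapping.single (\<alpha>, i) 1\<close>.
\<close>

type_synonym 'a alg = "('a vec \<times> mindex) \<Rightarrow>\<^sub>0 'a"

definition ham_carrier :: "(nat \<Rightarrow> nat) \<Rightarrow> 'a::field vec set \<Rightarrow> 'a alg set" where
  "ham_carrier l \<Gamma> = {u. Poly_Mapping.keys u \<subseteq> \<Gamma> \<times> mindices l}"

definition scale :: "'a::field \<Rightarrow> ('k \<Rightarrow>\<^sub>0 'a) \<Rightarrow> ('k \<Rightarrow>\<^sub>0 'a)" where
  "scale c u = Poly_Mapping.map ((*) c) u"

definition xpow :: "'a::field vec \<Rightarrow> 'a alg" where
  "xpow \<alpha> = Poly_Mapping.single (\<alpha>, 0) 1"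

definition d_star :: "nat \<Rightarrow> 'a::field alg \<Rightarrow> 'a alg" where
  "d_star p u =
    (\<Sum>(\<alpha>, i)\<in>Poly_Mapping.keys u.
      Poly_Mapping.single (\<alpha>, i)
        (Poly_Mapping.lookup u (\<alpha>, i) * Poly_Mapping.lookup \<alpha> p))"

text \<open>
  Subtraction of multi-indices is truncated, but where truncation takes effect the coefficient
  \<open>i\<^sub>p\<close> vanishes.
\<close>

definition d_t :: "nat \<Rightarrow> 'a::field alg \<Rightarrow> 'a alg" where
  "d_t p u =
    (\<Sum>(\<alpha>, i)\<in>Poly_Mapping.keys u.
      Poly_Mapping.single (\<alpha>, i - Poly_Mapping.single p 1)
        (Poly_Mapping.lookup u (\<alpha>, i) * of_nat (Poly_Mapping.lookup i p)))"

definition d_full :: "nat \<Rightarrow> 'a::field alg \<Rightarrow> 'a alg" where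
  "d_full p u = d_star p u + d_t p u"

definition ham_bracket :: "(nat \<Rightarrow> nat) \<Rightarrow> 'a::field alg \<Rightarrow> 'a alg \<Rightarrow> 'a alg" where
  "ham_bracket l u v =
    (\<Sum>p\<in>idx_I l 1 7.
      xpow (sigma l p) *
        (d_full p u * d_full (bar l p) v - d_full (bar l p) u * d_full p v))"


section \<open>Isomorphisms\<close>

text \<open>
  A map between carriers is a function on the whole type of which only the values on the source
  carrier are constrained.
\<close>

definition linear_bij ::
  "(('k \<Rightarrow>\<^sub>0 'a::field) \<Rightarrow> ('l \<Rightarrow>\<^sub>0 'a)) \<Rightarrow> ('k \<Rightarrow>\<^sub>0 'a) set \<Rightarrow> ('l \<Rightarrow>\<^sub>0 'a) set \<Rightarrow> bool" where
  "linear_bij f A B \<longleftrightarrow>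
    bij_betw f A B \<and>
    (\<forall>u\<in>A. \<forall>v\<in>A. f (u + v) = f u + f v) \<and>
    (\<forall>c. \<forall>u\<in>A. f (scale c u) = scale c (f u))"

definition preserves_op ::
  "('u \<Rightarrow> 'v) \<Rightarrow> 'u set \<Rightarrow> ('u \<Rightarrow> 'u \<Rightarrow> 'u) \<Rightarrow> ('v \<Rightarrow> 'v \<Rightarrow> 'v) \<Rightarrow> bool" where
  "preserves_op f A m m' \<longleftrightarrow> (\<forall>u\<in>A. \<forall>v\<in>A. f (m u v) = m' (f u) (f v))"

definition lie_isomorphic ::
  "(nat \<Rightarrow> nat) \<Rightarrow> 'a::field vec set \<Rightarrow> (nat \<Rightarrow> nat) \<Rightarrow> 'a vec set \<Rightarrow> bool" where
  "lie_isomorphic l \<Gamma> l' \<Gamma>' \<longleftrightarrow>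
    (\<exists>f. linear_bij f (ham_carrier l \<Gamma>) (ham_carrier l' \<Gamma>') \<and>
         preserves_op f (ham_carrier l \<Gamma>) (ham_bracket l) (ham_bracket l'))"

definition poisson_isomorphic ::
  "(nat \<Rightarrow> nat) \<Rightarrow> 'a::field vec set \<Rightarrow> (nat \<Rightarrow> nat) \<Rightarrow> 'a vec set \<Rightarrow> bool" where
  "poisson_isomorphic l \<Gamma> l' \<Gamma>' \<longleftrightarrow>
    (\<exists>f. linear_bij f (ham_carrier l \<Gamma>) (ham_carrier l' \<Gamma>') \<and>
         preserves_op f (ham_carrier l \<Gamma>) (*) (*) \<and>
         preserves_op f (ham_carrier l \<Gamma>) (ham_bracket l) (ham_bracket l'))"

end

theory Submission
  imports Defs
begin

text \<open>
  Only one direction needs an argument. A Lie isomorphism \<open>f\<close> maps the unit of one algebra to a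
  central element of the other, and the center consists of the scalars, so a scalar multiple of \<open>f\<close>
  preserves the unit. Pulling back the associative product of the target along it gives a second
  commutative product \<open>\<circ>\<close> on \<open>A = \<A>(\<ell>, \<Gamma>)\<close> with the same unit, for which the given Lie bracket
  is again a derivation. The point is that such a product is essentially unique.

  Let \<open>T u v = u \<circ> v - u v\<close>. This is a symmetric bilinear map that is invariant under the Lie
  algebra. If \<open>[u, w] = 1\<close>, then evaluating \<open>[u\<^sup>2, w \<circ> z]\<close> with either Leibniz rule yields
  \<open>T u z = 0\<close> for all \<open>z\<close> in the centralizer of \<open>u\<close> (\<open>T_slice_centralizer\<close>); applying \<open>ad v\<close> to
  \<open>T u u = 0\<close> yields that \<open>T u\<close> vanishes on the image of \<open>ad u\<close> (\<open>T_image\<close>). Hence the two products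
  are equal as soon as some \<open>ad u\<close> is surjective (\<open>T_eq_0_if_surjective\<close>).

  If some variable \<open>t\<^sub>q\<close> is present, the derivation \<open>\<partial>\<^sub>q\<close> is surjective, and it is inner up to a unit
  (\<open>derivative_inner\<close>), so there is nothing left to show. Otherwise all index blocks but the first
  are empty and \<open>A\<close> is the group algebra of \<open>\<Gamma>\<close>. There \<open>[A, A]\<close> is contained in a hyperplane, the kernel of
  the coefficient \<open>\<tau>\<close> at \<open>x\<^sup>\<sigma>\<close> with \<open>\<sigma> = \<Sum>\<^sub>p \<sigma>\<^sub>p\<close>, and \<open>T\<close> need not vanish: the Lie
  automorphism \<open>u \<mapsto> u + c \<tau>(u)\<close> does not preserve the product. This is the only freedom. For a monomial
  \<open>u = x\<^sup>\<alpha>\<close> with \<open>\<alpha>\<close> in the plane of the coordinates \<open>p\<close>, \<open>p + \<iota>\<^sub>7\<close> and not a multiple of \<open>\<sigma>\<^sub>p\<close>, all \<open>T u x\<^sup>\<beta>\<close> with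
  \<open>\<beta> \<noteq> \<sigma>, \<sigma> - \<alpha>\<close> vanish (\<open>T_xpow_nonexceptional\<close>), and \<open>T u x\<^sup>\<sigma>\<close> is a multiple of \<open>u\<close>
  (\<open>T_xpow_sigma_total\<close>). After composition with one of the automorphisms above this multiple is
  \<open>0\<close>, and then \<open>T u = 0\<close>. The elements \<open>g\<close> with \<open>T g = 0\<close> form a subalgebra that is also a Lie
  ideal, and one that contains \<open>u\<close> is everything (\<open>T_eq_0_if_unit\<close>).

  So \<open>f\<close> is, up to a scalar and such a correction, multiplicative, and it respects the bracket up to
  a nonzero scalar \<open>k\<close>. The scalar is removed by an automorphism of the algebra \<open>A\<close>
  that multiplies the bracket by \<open>k\<close> (\<open>twist_br\<close>). It scales some of the variables \<open>t\<close>
  by \<open>1 / k\<close> and \<open>x\<^sup>\<alpha>\<close> by a character of \<open>\<Gamma>\<close> with value \<open>k\<close> at every \<open>\<sigma>\<^sub>p \<noteq> 0\<close>, and this is where the field has to be algebraically closed: the character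
  comes from a homomorphism \<open>e\<close> from the additive to the multiplicative group of the field with
  \<open>e 1 = k\<close> (\<open>additive_character\<close>), which requires roots of \<open>k\<close> of all orders.
\<close>

section \<open>Characters of the additive group of an algebraically closed field\<close>

lemma compatible_roots:
  fixes k :: "'a::alg_closed_field"
  obtains r :: "nat \<Rightarrow> 'a" where "r 0 = k" "\<And>n. r (Suc n) ^ Suc n = r n"
proof -
  have "\<exists>r. \<forall>n. (n = 0 \<longrightarrow> r n = k) \<and> r (Suc n) ^ Suc n = r n"
    by (rule dependent_nat_choice) (use nth_root_exists[where 'a='a] in \<open>auto simp del: power_Suc\<close>)
  then show ?thesis using that by blast
qed

text \<open>
  \<open>q \<mapsto> k\<^sup>q\<close>: with \<open>r n\<close> a root of \<open>k\<close> of order \<open>n!\<close>, the value at \<open>q\<close> is \<open>r n\<close> to the power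
  \<open>n! q\<close> as soon as that exponent is an integer, and compatibility of the roots makes the choice
  of \<open>n\<close> irrelevant.
\<close>
lemma rational_character:
  fixes k :: "'a::alg_closed_field"
  assumes k: "k \<noteq> 0"
  obtains g :: "rat \<Rightarrow> 'a" where "g 1 = k" "\<And>x y. g (x + y) = g x * g y"
proof -
  obtain r :: "nat \<Rightarrow> 'a" where r0: "r 0 = k" and rS: "\<And>n. r (Suc n) ^ Suc n = r n"
    using compatible_roots by blast
  have rnz: "r n \<noteq> 0" for n
  proof (induction n)
    case (Suc n)
    then show ?case using rS[of n] by (metis power_0_Suc)
  qed (simp add: r0 k)
  define N where "N q = nat (snd (quotient_of q))" for q
  have dvd_int: "\<exists>m. fact n * q = of_int m" if "n \<ge> N q" for n and q :: rat
  proof -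
    obtain a b where ab: "quotient_of q = (a, b)" by fastforce
    then have b: "b > 0" and q: "q = of_int a / of_int b"
      using quotient_of_denom_pos quotient_of_div by blast+
    have "nat b dvd fact n" using that b ab by (auto simp: N_def intro: dvd_fact)
    then have "int (nat b) dvd int (fact n)" by (simp only: of_nat_dvd_iff)
    then have "b dvd fact n" using b by simp
    then obtain c where c: "fact n = b * c" by (auto elim: dvdE)
    have "(fact n :: rat) = of_int (fact n)" by simp
    also have "\<dots> = of_int b * of_int c" by (simp only: c of_int_mult)
    finally have "fact n * q = of_int (c * a)" using b by (simp add: q)
    then show ?thesis by blast
  qed
  define g where "g q = r (N q) powi \<lfloor>fact (N q) * q\<rfloor>" for q
  have g_eq: "g q = r n powi \<lfloor>fact n * q\<rfloor>" if "n \<ge> N q" for n q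
    using that
  proof (induction n rule: dec_induct)
    case base
    show ?case by (simp add: g_def)
  next
    case (step n)
    obtain m where m: "fact n * q = of_int m" using dvd_int step by blast
    have "fact (Suc n) * q = of_int (int (Suc n) * m)" using m by (simp add: algebra_simps)
    then have "r (Suc n) powi \<lfloor>fact (Suc n) * q\<rfloor> = r (Suc n) powi (int (Suc n) * m)"
      by (simp only: floor_of_int)
    also have "\<dots> = (r (Suc n) powi int (Suc n)) powi m" by (rule power_int_mult)
    also have "\<dots> = r n powi m" using rS[of n] by (simp only: power_int_of_nat)
    finally show ?case using step m by simp
  qed
  have "g (x + y) = g x * g y" for x y
  proof -
    define n where "n = Max {N x, N y, N (x + y)}"
    have n: "n \<ge> N x" "n \<ge> N y" "n \<ge> N (x + y)" by (auto simp: n_def)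
    obtain a b where a: "fact n * x = of_int a" and b: "fact n * y = of_int b"
      using dvd_int n by meson
    have "fact n * (x + y) = of_int (a + b)" using a b by (simp add: algebra_simps)
    then show ?thesis using g_eq[OF n(1)] g_eq[OF n(2)] g_eq[OF n(3)] a b rnz
      by (simp only: floor_of_int power_int_add simp_thms)
  qed
  moreover have "g 1 = k" using g_eq[of 1 1] rS[of 0] r0 by (simp add: N_def)
  ultimately show ?thesis using that by blast
qed

text \<open>
  The coordinate of \<open>1\<close> with respect to a basis of the field over the rationals that contains \<open>1\<close>.
\<close>
lemma rational_functional:
  obtains f :: "'a::field_char_0 \<Rightarrow> rat" where "f 1 = 1" "\<And>x y. f (x + y) = f x + f y"
proof -
  interpret Q: vector_space "\<lambda>(q::rat) (x::'a). of_rat q * x"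
    by unfold_locales (auto simp: algebra_simps of_rat_add of_rat_mult)
  have ind: "Q.independent {1}" by (simp add: Q.dependent_single)
  note B = Q.independent_extend_basis[OF ind] Q.span_extend_basis[OF ind]
  define f where "f x = Q.representation (Q.extend_basis {1}) x 1" for x
  have "f 1 = 1"
    using Q.representation_basis[OF B(1), of 1] Q.extend_basis_superset[OF ind] by (simp add: f_def)
  moreover have "f (x + y) = f x + f y" for x y
    using Q.representation_add[OF B(1), of y x] B(2) by (simp add: f_def)
  ultimately show ?thesis using that by blast
qed

lemma additive_character:
  fixes k :: "'a::{alg_closed_field, field_char_0}"
  assumes "k \<noteq> 0"
  obtains e :: "'a \<Rightarrow> 'a" where "e 1 = k" "\<And>x y. e (x + y) = e x * e y" "e 0 = 1"
proof -
  obtain f :: "'a \<Rightarrow> rat" where f: "f 1 = 1" "\<And>x y. f (x + y) = f x + f y"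
    using rational_functional by blast
  obtain g :: "rat \<Rightarrow> 'a" where g: "g 1 = k" "\<And>x y. g (x + y) = g x * g y"
    using rational_character[OF assms] by blast
  have "g (f 1) = g (f 0) * g (f 1)" by (metis add_0 f(2) g(2))
  then have "g (f 0) = 1" using assms f g by simp
  then show ?thesis using that[of "g \<circ> f"] f g by simp
qed

section \<open>Two Poisson products for one Lie bracket\<close>

text \<open>
  The algebra is a subring \<open>A\<close> of an ambient ring, and the field of scalars enters through its
  embedding \<open>C\<close> into \<open>A\<close>; multiplication by a scalar is multiplication by an element of \<open>A\<close>.
\<close>
locale poisson_subring =
  fixes A :: "'r::comm_ring_1 set" and br :: "'r \<Rightarrow> 'r \<Rightarrow> 'r" and C :: "'k::field_char_0 \<Rightarrow> 'r"
  assumes add_closed [simp, intro]: "u \<in> A \<Longrightarrow> v \<in> A \<Longrightarrow> u + v \<in> A"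
    and mult_closed [simp, intro]: "u \<in> A \<Longrightarrow> v \<in> A \<Longrightarrow> u * v \<in> A"
    and br_closed [simp, intro]: "u \<in> A \<Longrightarrow> v \<in> A \<Longrightarrow> br u v \<in> A"
    and C_closed [simp, intro]: "C c \<in> A"
    and C_1 [simp]: "C 1 = 1"
    and C_add: "C (c + d) = C c + C d"
    and C_mult: "C (c * d) = C c * C d"
    and br_add_right: "br u (v + w) = br u v + br u w"
    and br_skew: "br u v = - br v u"
    and br_self [simp]: "br u u = 0"
    and br_mult_right: "br u (v * w) = br u v * w + v * br u w"
    and br_C_right [simp]: "br u (C c) = 0"
begin

lemma C_0 [simp]: "C 0 = 0"
  using C_add[of 0 0] by simp

lemma C_minus: "C (- c) = - C c"
  using C_add[of c "- c"] by (simp add: eq_neg_iff_add_eq_0 add.commute)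

lemma one_closed [simp, intro]: "1 \<in> A"
  using C_closed[of 1] by simp

lemma zero_closed [simp, intro]: "0 \<in> A"
  using C_closed[of 0] by simp

lemma minus_closed [simp, intro]: "u \<in> A \<Longrightarrow> - u \<in> A"
  using mult_closed[OF C_closed[of "- 1"], of u] by (simp add: C_minus)

lemma diff_closed [simp, intro]: "u \<in> A \<Longrightarrow> v \<in> A \<Longrightarrow> u - v \<in> A"
  using add_closed[of u "- v"] by simp

lemma C_cancel: "c \<noteq> 0 \<Longrightarrow> C c * u = C c * v \<Longrightarrow> u = v"
  using C_mult[of "inverse c" c] by (metis C_1 field_class.field_inverse mult.assoc mult_1)

lemma C_2: "C 2 * u = u + u"
  using C_add[of 1 1] by (simp add: distrib_right)

lemma double_cancel: "u + u = v + v \<Longrightarrow> u = (v::'r)"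
  using C_cancel[of 2] C_2 by (metis zero_neq_numeral)

lemma br_C_left [simp]: "br (C c) u = 0"
  using br_skew[of "C c" u] by simp

lemma br_1 [simp]: "br 1 u = 0" "br u 1 = 0"
  using br_C_left[of 1] br_C_right[of _ 1] by simp_all

lemma br_0 [simp]: "br 0 u = 0" "br u 0 = 0"
  using br_C_left[of 0] br_C_right[of _ 0] by simp_all

lemma br_add_left: "br (u + v) w = br u w + br v w"
  using br_skew br_add_right by (metis minus_add_distrib)

lemma br_mult_left: "br (u * v) w = br u w * v + u * br v w"
  using br_skew[of "u * v"] br_skew[of w u] br_skew[of w v] by (simp add: br_mult_right)

lemma br_scale_right: "br u (C c * v) = C c * br u v"
  by (simp add: br_mult_right)

lemma br_scale_left: "br (C c * u) v = C c * br u v"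
  by (simp add: br_mult_left)

lemma br_minus_right: "br u (- v) = - br u v"
  using br_scale_right[of u "- 1" v] by (simp add: C_minus)

lemma br_diff_right: "br u (v - w) = br u v - br u w"
  using br_add_right[of u v "- w"] by (simp add: br_minus_right)

end

locale second_product = poisson_subring A br C
  for A :: "'r::comm_ring_1 set" and br :: "'r \<Rightarrow> 'r \<Rightarrow> 'r" and C :: "'k::field_char_0 \<Rightarrow> 'r" +
  fixes m :: "'r \<Rightarrow> 'r \<Rightarrow> 'r"
  assumes m_closed [simp, intro]: "u \<in> A \<Longrightarrow> v \<in> A \<Longrightarrow> m u v \<in> A"
    and m_comm: "u \<in> A \<Longrightarrow> v \<in> A \<Longrightarrow> m u v = m v u"
    and m_assoc: "u \<in> A \<Longrightarrow> v \<in> A \<Longrightarrow> w \<in> A \<Longrightarrow> m (m u v) w = m u (m v w)"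
    and m_add_left: "u \<in> A \<Longrightarrow> v \<in> A \<Longrightarrow> w \<in> A \<Longrightarrow> m (u + v) w = m u w + m v w"
    and m_C_left: "u \<in> A \<Longrightarrow> m (C c) u = C c * u"
    and br_m: "u \<in> A \<Longrightarrow> v \<in> A \<Longrightarrow> w \<in> A \<Longrightarrow> br u (m v w) = m (br u v) w + m v (br u w)"
begin

lemma m_add_right: "u \<in> A \<Longrightarrow> v \<in> A \<Longrightarrow> w \<in> A \<Longrightarrow> m u (v + w) = m u v + m u w"
  using m_add_left[of v w u] by (simp add: m_comm[of u])

lemma m_1 [simp]: "u \<in> A \<Longrightarrow> m 1 u = u" "u \<in> A \<Longrightarrow> m u 1 = u"
  using m_C_left[of u 1] m_comm[of u 1] by auto

lemma m_0 [simp]: "u \<in> A \<Longrightarrow> m 0 u = 0" "u \<in> A \<Longrightarrow> m u 0 = 0"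
  using m_C_left[of u 0] m_comm[of u 0] by auto

lemma m_scale_left: "u \<in> A \<Longrightarrow> v \<in> A \<Longrightarrow> m (C c * u) v = C c * m u v"
  by (metis m_assoc m_C_left C_closed m_closed)

lemma m_scale_right: "u \<in> A \<Longrightarrow> v \<in> A \<Longrightarrow> m u (C c * v) = C c * m u v"
  by (metis m_scale_left m_comm mult_closed C_closed)

lemma m_double: "u \<in> A \<Longrightarrow> v \<in> A \<Longrightarrow> m (2 * u) v = 2 * m u v"
  using m_add_left[of u u v] by simp

definition T :: "'r \<Rightarrow> 'r \<Rightarrow> 'r" where
  "T u v = m u v - u * v"

lemma T_closed [simp, intro]: "u \<in> A \<Longrightarrow> v \<in> A \<Longrightarrow> T u v \<in> A"
  by (simp add: T_def)

lemma T_sym: "u \<in> A \<Longrightarrow> v \<in> A \<Longrightarrow> T u v = T v u"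
  by (simp add: T_def m_comm[of u v] mult.commute)

lemma T_add_left: "u \<in> A \<Longrightarrow> v \<in> A \<Longrightarrow> w \<in> A \<Longrightarrow> T (u + v) w = T u w + T v w"
  by (simp add: T_def m_add_left algebra_simps)

lemma T_add_right: "u \<in> A \<Longrightarrow> v \<in> A \<Longrightarrow> w \<in> A \<Longrightarrow> T w (u + v) = T w u + T w v"
  by (simp add: T_def m_add_right algebra_simps)

lemma T_scale_left: "u \<in> A \<Longrightarrow> v \<in> A \<Longrightarrow> T (C c * u) v = C c * T u v"
  by (simp add: T_def m_scale_left right_diff_distrib mult.assoc)

lemma T_scale_right: "u \<in> A \<Longrightarrow> v \<in> A \<Longrightarrow> T u (C c * v) = C c * T u v"
  by (simp add: T_def m_scale_right right_diff_distrib mult.left_commute)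

lemma T_C [simp]: "u \<in> A \<Longrightarrow> T u (C c) = 0" "u \<in> A \<Longrightarrow> T (C c) u = 0"
  using m_comm[of u "C c"] by (simp_all add: T_def m_C_left)

lemma T_0 [simp]: "u \<in> A \<Longrightarrow> T u 0 = 0" "u \<in> A \<Longrightarrow> T 0 u = 0"
  using T_C[of u 0] by simp_all

text \<open>The defect is invariant under the Lie algebra, since both products are.\<close>
lemma br_T: "w \<in> A \<Longrightarrow> u \<in> A \<Longrightarrow> v \<in> A \<Longrightarrow> br w (T u v) = T (br w u) v + T u (br w v)"
  by (simp add: T_def br_diff_right br_m br_mult_right algebra_simps)

text \<open>
  The source of all vanishing: \<open>[u\<^sup>2, w \<circ> z]\<close> computed with \<open>ad (u\<^sup>2) = 2 u (ad u)\<close> gives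
  \<open>2 u z\<close>, and computed by the Leibniz rule for the second product it gives \<open>2 (u \<circ> z)\<close>.
\<close>
lemma T_slice_centralizer:
  assumes [simp]: "u \<in> A" "w \<in> A" "z \<in> A" and uw: "br u w = 1" and uz: "br u z = 0"
  shows "T u z = 0"
proof -
  have "br (u * u) (m w z) = u * z + u * z"
    by (simp add: br_mult_left br_m uw uz distrib_right)
  moreover have "br (u * u) (m w z) = m u z + m u z"
    by (subst br_m) (simp_all add: br_mult_left uw uz m_double)
  ultimately show ?thesis using double_cancel[of "u * z" "m u z"] by (simp add: T_def)
qed

text \<open>
  Apply \<open>ad v\<close> to \<open>T u u = 0\<close>.
\<close>
lemma T_image:
  assumes [simp]: "u \<in> A" "v \<in> A" and "T u u = 0"
  shows "T u (br v u) = 0"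
proof -
  have "T u (br v u) + T u (br v u) = 0 + 0"
    using br_T[of v u u] assms T_sym[of u "br v u"] by simp
  then show ?thesis by (rule double_cancel)
qed

lemma T_slice_image:
  assumes "u \<in> A" "w \<in> A" "v \<in> A" "br u w = 1"
  shows "T u (br u v) = 0"
  using T_image[of u "- v"] T_slice_centralizer[of u w u] assms br_skew[of u v]
  by (simp add: br_minus_right br_skew[of "- v"])

text \<open>Invariance of \<open>T\<close> makes its radical a Lie ideal.\<close>
lemma T_ideal:
  assumes "u \<in> A" "v \<in> A" "\<And>x. x \<in> A \<Longrightarrow> T u x = 0" "x \<in> A"
  shows "T (br v u) x = 0"
  using br_T[of v u x] assms by simp

text \<open>
  A preimage of \<open>1\<close> under \<open>ad u\<close> makes \<open>T u\<close> vanish on the image of \<open>ad u\<close>, that is, everywhere; and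
  then so does \<open>T [v, u]\<close>, where \<open>[v, u]\<close> is arbitrary.
\<close>
lemma T_eq_0_if_surjective:
  assumes u: "u \<in> A" and surj: "\<And>y. y \<in> A \<Longrightarrow> \<exists>v\<in>A. br u v = y"
    and x: "x \<in> A" "y \<in> A"
  shows "T x y = 0"
proof -
  obtain w where w: "w \<in> A" "br u w = 1" using surj[OF one_closed] by blast
  have Tu: "T u z = 0" if "z \<in> A" for z
    using surj[OF that] T_slice_image[OF u w(1) _ w(2)] by blast
  obtain v where v: "v \<in> A" "br u v = - x" using surj[of "- x"] x by auto
  then have "br v u = x" using br_skew[of v u] by simp
  then show ?thesis using T_ideal[OF u v(1) Tu x(2)] by simp
qed

text \<open>
  The set \<open>G\<close> of elements on which the products agree is a subalgebra and a Lie ideal, so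
  \<open>a [g', g] = [a g', g] - g' [a, g]\<close> puts the ideal generated by \<open>[G, G]\<close> into \<open>G\<close>. Under
  the hypotheses \<open>u\<close> and \<open>u\<^sup>-\<^sup>1 h\<close> are in \<open>G\<close>, and their bracket is a nonzero scalar.
\<close>
lemma T_eq_0_if_unit:
  assumes u: "u \<in> A" "u' \<in> A" "u * u' = 1" and h: "h \<in> A" "br h u = C c * u" "c \<noteq> 0"
    and Tu: "\<And>x. x \<in> A \<Longrightarrow> T u x = 0" and xy: "x \<in> A" "y \<in> A"
  shows "T x y = 0"
proof -
  define G where "G = {g \<in> A. \<forall>x\<in>A. T g x = 0}"
  have uG: "u \<in> G" using u Tu by (auto simp: G_def)
  have G_diff: "g - g' \<in> G" if "g \<in> G" "g' \<in> G" for g g'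
    using that T_add_left[of g "C (- 1) * g'"] T_scale_left[of g' _ "- 1"]
    by (auto simp: G_def C_minus)
  have G_scale: "C d * g \<in> G" if "g \<in> G" for g d
    using that by (auto simp: G_def T_scale_left)
  have G_mult: "g * g' \<in> G" if "g \<in> G" "g' \<in> G" for g g'
  proof -
    have g: "g \<in> A" "g' \<in> A" "\<And>x. x \<in> A \<Longrightarrow> m g x = g * x" "\<And>x. x \<in> A \<Longrightarrow> m g' x = g' * x"
      using that by (auto simp: G_def T_def)
    then have "m (g * g') x = g * g' * x" if "x \<in> A" for x
      using m_assoc[of g g' x] that by (simp add: mult.assoc)
    then show ?thesis using g by (simp add: G_def T_def)
  qed
  have G_ideal: "br a g \<in> G" if "g \<in> G" "a \<in> A" for a g
    using T_ideal[of g a] that by (auto simp: G_def)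
  have "br u' u * u + u' * br u u = br (u' * u) u" by (simp add: br_mult_left)
  then have "br u' u * u = 0" using u by (simp add: mult.commute)
  then have u'u: "br u' u = 0" using u by (metis mult.assoc mult.commute mult_1 mult_zero_left)
  define g where "g = C (inverse (2 * c)) * br (u' * u' * h * h) u"
  have "br (u' * u' * h * h) u = u' * u' * (C c * u * h + h * (C c * u))"
    by (simp add: br_mult_left h u'u algebra_simps)
  also have "\<dots> = C c * (u * u') * (u' * h + u' * h)" by (simp add: algebra_simps)
  also have "\<dots> = C (2 * c) * (u' * h)" by (simp add: u C_mult C_2 mult.assoc distrib_left)
  finally have "g = C (inverse (2 * c)) * (C (2 * c) * (u' * h))" by (simp only: g_def)
  also have "\<dots> = C (inverse (2 * c) * (2 * c)) * (u' * h)" by (simp only: C_mult mult.assoc)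
  finally have g: "g = u' * h" using h by (simp del: inverse_mult_distrib)
  have gG: "g \<in> G" unfolding g_def by (intro G_scale G_ideal uG) (use u h in auto)
  have "br g u = C c * (u * u')" by (simp add: g br_mult_left u'u h ac_simps)
  then have gu: "br g u = C c" by (simp add: u)
  have "a \<in> G" if a: "a \<in> A" for a
  proof -
    have "br (a * g) u - g * br a u = C c * a" by (simp add: br_mult_left gu)
    moreover have "br (a * g) u - g * br a u \<in> G"
      using a gG uG by (intro G_diff G_ideal G_mult) (auto simp: G_def)
    ultimately have "C (inverse c) * (C c * a) \<in> G" using G_scale by metis
    then show ?thesis using h by (simp flip: mult.assoc C_mult)
  qed
  then show ?thesis using xy by (auto simp: G_def)
qed

text \<open>
  Used for functions \<open>u\<close> and \<open>z\<close> of disjoint sets of coordinates: the image of \<open>(ad z)\<^sup>2\<close> consists of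
  elements that need not lie in the image or the kernel of \<open>ad u\<close>.
\<close>
lemma T_slices_commute:
  assumes [simp]: "u \<in> A" "z \<in> A" "v \<in> A"
    and u: "w \<in> A" "br u w = 1" and z: "w' \<in> A" "br z w' = 1"
    and uz: "br u z = 0" and jacobi: "br u (br z v) = br z (br u v)"
  shows "T u (br z (br z v)) = 0"
proof -
  have zu: "br z u = 0" using uz br_skew[of z u] by simp
  have Tuz: "T u z = 0" using T_slice_centralizer[of u w z] u uz by simp
  \<comment> \<open>by invariance of \<open>T u z = 0\<close> one of the two \<open>ad z\<close> moves to the other argument as \<open>ad u\<close>\<close>
  have swap: "T u (br z y) = - T z (br u y)" if y [simp]: "y \<in> A" for y
  proof -
    have "T (br y u) z + T u (br y z) = 0" using br_T[of y u z] Tuz by simp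
    moreover have "T (br y u) z = - T z (br u y)"
      using T_scale_right[of z "br u y" "- 1"] T_sym[of "br y u" z] br_skew[of y u]
      by (simp add: C_minus)
    moreover have "T u (br y z) = - T u (br z y)"
      using T_scale_right[of u "br z y" "- 1"] br_skew[of y z] by (simp add: C_minus)
    ultimately show ?thesis by (simp add: add_eq_0_iff)
  qed
  have "T u (br z (br z v)) = - T z (br z (br u v))" by (simp add: swap jacobi)
  also have "\<dots> = 0" using T_slice_image[of z w' "br u v"] z by simp
  finally show ?thesis .
qed

end

lemma (in poisson_subring) second_product_mult: "second_product A br C (*)"
  by unfold_locales (auto simp: algebra_simps br_mult_right)

text \<open>
  A product is pulled back along a linear bijection that respects the brackets up to a scalar: the
  Leibniz rule is homogeneous in the bracket.
\<close>
lemma second_product_pullback: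
  fixes A :: "'r::comm_ring_1 set" and B :: "'s::comm_ring_1 set" and C :: "'k::field_char_0 \<Rightarrow> 'r"
  assumes A: "poisson_subring A br C" and B: "second_product B br' C' m"
    and bij: "bij_betw \<theta> A B"
    and add: "\<And>u v. u \<in> A \<Longrightarrow> v \<in> A \<Longrightarrow> \<theta> (u + v) = \<theta> u + \<theta> v"
    and scale: "\<And>c u. u \<in> A \<Longrightarrow> \<theta> (C c * u) = C' c * \<theta> u"
    and one: "\<theta> 1 = 1"
    and bracket: "\<And>u v. u \<in> A \<Longrightarrow> v \<in> A \<Longrightarrow> \<theta> (br u v) = C' \<kappa> * br' (\<theta> u) (\<theta> v)"
  shows "second_product A br C (\<lambda>u v. inv_into A \<theta> (m (\<theta> u) (\<theta> v)))"
proof -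
  interpret A: poisson_subring A br C by fact
  interpret B: second_product B br' C' m by fact
  have mem [simp]: "\<theta> u \<in> B" if "u \<in> A" for u using bij that by (auto simp: bij_betw_def)
  have inv_mem [simp]: "inv_into A \<theta> x \<in> A" if "x \<in> B" for x
    using that bij by (metis bij_betw_imp_surj_on inv_into_into)
  have inv [simp]: "\<theta> (inv_into A \<theta> x) = x" if "x \<in> B" for x
    using that bij by (metis bij_betw_inv_into_right)
  have inj: "u = v" if "u \<in> A" "v \<in> A" "\<theta> u = \<theta> v" for u v
    using that bij by (auto simp: bij_betw_def dest: inj_onD)
  have C: "\<theta> (C c) = C' c" for c using scale[of 1 c] one by simp
  show ?thesis
  proof
    fix u v w c assume [simp]: "u \<in> A" "v \<in> A"
    show "inv_into A \<theta> (m (\<theta> u) (\<theta> v)) \<in> A" by simp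
    show "inv_into A \<theta> (m (\<theta> u) (\<theta> v)) = inv_into A \<theta> (m (\<theta> v) (\<theta> u))" by (simp add: B.m_comm)
    show "inv_into A \<theta> (m (\<theta> (C c)) (\<theta> u)) = C c * u"
      by (rule inj) (simp_all add: C scale B.m_C_left)
    assume [simp]: "w \<in> A"
    show "inv_into A \<theta> (m (\<theta> (inv_into A \<theta> (m (\<theta> u) (\<theta> v)))) (\<theta> w)) =
        inv_into A \<theta> (m (\<theta> u) (\<theta> (inv_into A \<theta> (m (\<theta> v) (\<theta> w)))))"
      by (simp add: B.m_assoc)
    show "inv_into A \<theta> (m (\<theta> (u + v)) (\<theta> w)) =
        inv_into A \<theta> (m (\<theta> u) (\<theta> w)) + inv_into A \<theta> (m (\<theta> v) (\<theta> w))"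
      by (rule inj) (simp_all add: add B.m_add_left)
    show "br u (inv_into A \<theta> (m (\<theta> v) (\<theta> w))) =
        inv_into A \<theta> (m (\<theta> (br u v)) (\<theta> w)) + inv_into A \<theta> (m (\<theta> v) (\<theta> (br u w)))"
      by (rule inj)
        (simp_all add: add bracket B.br_m B.m_scale_left B.m_scale_right distrib_left)
  qed
qed

section \<open>Derivations and bracket of the Hamiltonian Poisson algebra\<close>

lemma keys_induct [consumes 1, case_names single add]:
  fixes u :: "'k \<Rightarrow>\<^sub>0 'a::comm_monoid_add"
  assumes "Poly_Mapping.keys u \<subseteq> S"
    and single: "\<And>k c. k \<in> S \<or> c = 0 \<Longrightarrow> P (Poly_Mapping.single k c)"
    and add: "\<And>f g. Poly_Mapping.keys f \<subseteq> S \<Longrightarrow> Poly_Mapping.keys g \<subseteq> S \<Longrightarrow> P f \<Longrightarrow> P g \<Longrightarrow> P (f + g)"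
  shows "P u"
  using assms(1)
proof (induction u rule: update_induct)
  case const
  show ?case using single[of _ 0] by simp
next
  case (update f a b)
  have eq: "Poly_Mapping.update a b f = f + Poly_Mapping.single a b"
    using update(1) by (intro poly_mapping_eqI)
      (auto simp: lookup_update lookup_add lookup_single when_def in_keys_iff)
  have "Poly_Mapping.keys (Poly_Mapping.update a b f) = insert a (Poly_Mapping.keys f)"
    using update by (auto simp: keys_update)
  then have k: "a \<in> S" "Poly_Mapping.keys f \<subseteq> S" using update by auto
  then have "Poly_Mapping.keys (Poly_Mapping.single a b) \<subseteq> S" by auto
  then show ?case unfolding eq using k update.IH by (intro add single) auto
qed

lemma d_star_single: "d_star p (Poly_Mapping.single (\<alpha>, i) c) =
    Poly_Mapping.single (\<alpha>, i) (c * Poly_Mapping.lookup \<alpha> p)"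
  by (cases "c = 0") (simp_all add: d_star_def)

lemma d_t_single: "d_t p (Poly_Mapping.single (\<alpha>, i) c) =
    Poly_Mapping.single (\<alpha>, i - Poly_Mapping.single p 1) (c * of_nat (Poly_Mapping.lookup i p))"
  by (cases "c = 0") (simp_all add: d_t_def)

lemma d_star_add: "d_star p (u + v) = d_star p u + d_star p v"
  using setsum_keys_plus_distrib[of
      "\<lambda>k x. Poly_Mapping.single k (x * Poly_Mapping.lookup (fst k) p)" u v]
  by (simp add: d_star_def case_prod_unfold distrib_right single_add)

lemma d_t_add: "d_t p (u + v) = d_t p u + d_t p v"
  using setsum_keys_plus_distrib[of "\<lambda>k x. Poly_Mapping.single (fst k, snd k - Poly_Mapping.single p 1)
      (x * of_nat (Poly_Mapping.lookup (snd k) p))" u v]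
  by (simp add: d_t_def case_prod_unfold distrib_right single_add)

lemma d_full_add: "d_full p (u + v) = d_full p u + d_full p v"
  by (simp add: d_full_def d_star_add d_t_add)

lemma d_full_single: "d_full p (Poly_Mapping.single (\<alpha>, i) c) =
    Poly_Mapping.single (\<alpha>, i) (c * Poly_Mapping.lookup \<alpha> p) +
    Poly_Mapping.single (\<alpha>, i - Poly_Mapping.single p 1) (c * of_nat (Poly_Mapping.lookup i p))"
  by (simp add: d_full_def d_star_single d_t_single)

lemma mindex_diff_add:
  fixes i j :: mindex
  assumes "Poly_Mapping.lookup i p \<noteq> 0"
  shows "i - Poly_Mapping.single p 1 + j = i + j - Poly_Mapping.single p 1"
  using assms by (intro poly_mapping_eqI) (auto simp: lookup_add lookup_minus lookup_single when_def)

lemma d_t_mult_single: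
  "d_t p (Poly_Mapping.single (\<alpha>, i) c * Poly_Mapping.single (\<beta>, j) d) =
    d_t p (Poly_Mapping.single (\<alpha>, i) c) * Poly_Mapping.single (\<beta>, j) d +
    Poly_Mapping.single (\<alpha>, i) c * d_t p (Poly_Mapping.single (\<beta>, j) (d::'a::field))"
proof -
  have "Poly_Mapping.single (\<alpha> + \<beta>, i + j - Poly_Mapping.single p 1)
        (c * d * of_nat (Poly_Mapping.lookup i p)) =
      Poly_Mapping.single (\<alpha> + \<beta>, i - Poly_Mapping.single p 1 + j)
        (c * of_nat (Poly_Mapping.lookup i p) * d)"
    by (cases "Poly_Mapping.lookup i p = 0") (simp_all add: mindex_diff_add[unfolded One_nat_def] mult_ac)
  moreover have "Poly_Mapping.single (\<alpha> + \<beta>, i + j - Poly_Mapping.single p 1)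
        (c * d * of_nat (Poly_Mapping.lookup j p)) =
      Poly_Mapping.single (\<alpha> + \<beta>, i + (j - Poly_Mapping.single p 1))
        (c * (d * of_nat (Poly_Mapping.lookup j p)))"
    using mindex_diff_add[of j p i]
    by (cases "Poly_Mapping.lookup j p = 0") (simp_all add: add.commute mult_ac)
  ultimately show ?thesis
    by (simp add: mult_single d_t_single lookup_add distrib_left single_add)
qed

lemma d_full_mult: "d_full p (u * v) = d_full p u * v + u * d_full p v"
proof -
  have *: "d_full p (Poly_Mapping.single k c * Poly_Mapping.single k' c') =
      d_full p (Poly_Mapping.single k c) * Poly_Mapping.single k' c' +
      Poly_Mapping.single k c * d_full p (Poly_Mapping.single k' c')" for k k' c c'
    using d_t_mult_single[of p "fst k" "snd k" c "fst k'" "snd k'" c']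
    by (cases k, cases k')
      (simp add: d_full_def distrib_left distrib_right mult_single d_star_single lookup_add
        single_add mult_ac add.commute)
  have **: "d_full p (Poly_Mapping.single k c * v) =
      d_full p (Poly_Mapping.single k c) * v + Poly_Mapping.single k c * d_full p v" for k c
  proof -
    have "Poly_Mapping.keys v \<subseteq> UNIV" by simp
    then show ?thesis
      by (induction v rule: keys_induct) (simp_all add: * distrib_left d_full_add)
  qed
  have "Poly_Mapping.keys u \<subseteq> UNIV" by simp
  then show ?thesis
    by (induction u rule: keys_induct) (simp_all add: ** distrib_right d_full_add)
qed

lemma d_full_const: "d_full p (Poly_Mapping.single 0 c) = 0"
  using d_full_single[of p 0 0 c] by (simp flip: zero_prod_def)

lemma d_full_xpow: "d_full p (xpow \<alpha>) = Poly_Mapping.single 0 (Poly_Mapping.lookup \<alpha> p) * xpow \<alpha>"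
  by (simp add: xpow_def d_full_single mult_single flip: zero_prod_def)

lemma xpow_mult: "xpow \<alpha> * xpow \<beta> = xpow (\<alpha> + \<beta>)"
  by (simp add: xpow_def mult_single)

lemma xpow_0 [simp]: "xpow 0 = 1"
  by (simp add: xpow_def flip: zero_prod_def)

lemma scale_eq_mult: "scale c u = Poly_Mapping.single 0 c * u"
  by (simp add: scale_def mult_map_scale_conv_mult)

lemma lookup_C_mult: "Poly_Mapping.lookup (Poly_Mapping.single 0 c * u) k = c * Poly_Mapping.lookup u k"
  by (simp add: mult_map_scale_conv_mult[symmetric] Poly_Mapping.map.rep_eq when_def)

lemma ham_bracket_add_right: "ham_bracket l u (v + w) = ham_bracket l u v + ham_bracket l u w"
  by (simp add: ham_bracket_def d_full_add algebra_simps flip: sum.distrib)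

lemma ham_bracket_skew: "ham_bracket l u v = - ham_bracket l v u"
  by (simp add: ham_bracket_def algebra_simps flip: sum_negf)

lemma ham_bracket_self: "ham_bracket l u u = 0"
  by (simp add: ham_bracket_def algebra_simps)

lemma ham_bracket_mult_right:
  "ham_bracket l u (v * w) = ham_bracket l u v * w + v * ham_bracket l u w"
  by (simp add: ham_bracket_def d_full_mult algebra_simps sum.distrib sum_distrib_left sum_subtractf)

lemma ham_bracket_const: "ham_bracket l u (Poly_Mapping.single 0 c) = 0"
  by (simp add: ham_bracket_def d_full_const)

section \<open>Index sets\<close>

lemma iota_mono: "i \<le> j \<Longrightarrow> iota l i \<le> iota l j"
  unfolding iota_def by (intro sum_mono2) auto

lemma iota_0 [simp]: "iota l 0 = 0"
  by (simp add: iota_def)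

text \<open>The block \<open>I\<^sub>i\<close> containing an index; all index sets are unions of blocks.\<close>
definition block :: "(nat \<Rightarrow> nat) \<Rightarrow> nat \<Rightarrow> nat" where
  "block l p = (LEAST i. p \<le> iota l i)"

lemma block_le_iff: "p \<le> iota l 7 \<Longrightarrow> block l p \<le> j \<longleftrightarrow> p \<le> iota l j"
proof
  assume "p \<le> iota l 7" and j: "block l p \<le> j"
  then have "p \<le> iota l (block l p)" unfolding block_def by (intro LeastI)
  then show "p \<le> iota l j" using iota_mono[OF j, of l] by linarith
next
  show "p \<le> iota l j \<Longrightarrow> block l p \<le> j" unfolding block_def by (rule Least_le)
qed

locale hamiltonian =
  fixes l :: "nat \<Rightarrow> nat" and \<Gamma> :: "'a::field_char_0 vec set"
  assumes datum: "hamiltonian_datum l \<Gamma>"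
begin

abbreviation n :: nat where "n \<equiv> iota l 7"

abbreviation A :: "'a alg set" where "A \<equiv> ham_carrier l \<Gamma>"

abbreviation C :: "'a \<Rightarrow> 'a alg" where "C \<equiv> Poly_Mapping.single 0"

abbreviation br :: "'a alg \<Rightarrow> 'a alg \<Rightarrow> 'a alg" where "br \<equiv> ham_bracket l"

lemma idx_I_iff: "1 \<le> i \<Longrightarrow> j \<le> 7 \<Longrightarrow> p \<in> idx_I l i j \<longleftrightarrow> 1 \<le> p \<and> p \<le> n \<and> i \<le> block l p \<and> block l p \<le> j"
  using block_le_iff[of p l j] block_le_iff[of p l "i - 1"] iota_mono[of j 7 l]
  by (auto simp: idx_I_def)

lemma bar_idx_I_iff: "1 \<le> i \<Longrightarrow> j \<le> 7 \<Longrightarrow> q \<in> bar l ` idx_I l i j \<longleftrightarrow>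
    (\<exists>p. q = p + n \<and> 1 \<le> p \<and> p \<le> n \<and> i \<le> block l p \<and> block l p \<le> j)"
  by (auto simp: image_iff idx_I_iff bar_def)

lemma block_range: "1 \<le> p \<Longrightarrow> p \<le> n \<Longrightarrow> 1 \<le> block l p \<and> block l p \<le> 7"
  using block_le_iff[of p l 7] block_le_iff[of p l 0] by auto

lemma idx_I_all: "idx_I l 1 7 = {1..n}"
  by (auto simp: idx_I_def)

lemma bar_eq: "p \<le> n \<Longrightarrow> bar l p = p + n"
  by (simp add: bar_def)

lemma br_eq: "br u v = (\<Sum>p\<in>{1..n}. xpow (sigma l p) * (d_full p u * d_full (p + n) v - d_full (p + n) u * d_full p v))"
  unfolding ham_bracket_def idx_I_all by (intro sum.cong) (auto simp: bar_eq)

lemma idx_I_single: "1 \<le> i \<Longrightarrow> i \<le> 7 \<Longrightarrow> p \<in> idx_I l i i \<longleftrightarrow> 1 \<le> p \<and> p \<le> n \<and> block l p = i"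
  using idx_I_iff[of i i p] by (auto intro: le_antisym)

lemma bar_notin: "1 \<le> i \<Longrightarrow> j \<le> 7 \<Longrightarrow> p \<le> n \<Longrightarrow> p \<notin> bar l ` idx_I l i j"
  unfolding bar_idx_I_iff by auto

lemma sigma_eq:
  assumes "1 \<le> p" "p \<le> n"
  shows "(sigma l p :: 'a vec) = (if block l p \<in> {1, 3, 4} then Poly_Mapping.single p 1 + Poly_Mapping.single (p + n) 1
    else if block l p = 2 then Poly_Mapping.single p 1 else 0)"
proof -
  have "b = 1 \<or> 3 \<le> b \<and> b \<le> 4 \<longleftrightarrow> b \<in> {1, 3, 4}" for b :: nat by auto
  then have "p \<in> idx_J l 1 1 \<union> idx_J l 3 4 \<longleftrightarrow> block l p \<in> {1, 3, 4}"
    using assms by (simp add: idx_J_def idx_I_single idx_I_iff bar_notin)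
  moreover have "p \<in> idx_I l 2 2 \<longleftrightarrow> block l p = 2" using assms by (simp add: idx_I_single)
  moreover have "p \<notin> bar l ` idx_I l 2 2" using assms by (intro bar_notin) auto
  ultimately show ?thesis unfolding sigma_def bar_eq[OF assms(2)] by (simp only: if_False)
qed

lemma adm: "admissible_group l \<Gamma>"
  using datum by (simp add: hamiltonian_datum_def)

lemma \<Gamma>_0 [simp, intro]: "0 \<in> \<Gamma>"
  and \<Gamma>_add [simp, intro]: "\<alpha> \<in> \<Gamma> \<Longrightarrow> \<beta> \<in> \<Gamma> \<Longrightarrow> \<alpha> + \<beta> \<in> \<Gamma>"
  and \<Gamma>_minus [simp, intro]: "\<alpha> \<in> \<Gamma> \<Longrightarrow> - \<alpha> \<in> \<Gamma>"
  and \<Gamma>_keys: "\<alpha> \<in> \<Gamma> \<Longrightarrow> Poly_Mapping.keys \<alpha> \<subseteq> {1..2 * n}"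
  using adm by (auto simp: admissible_group_def additive_subgroup_of_def vec_space_def idx_all_def)

lemma \<Gamma>_diff [simp, intro]: "\<alpha> \<in> \<Gamma> \<Longrightarrow> \<beta> \<in> \<Gamma> \<Longrightarrow> \<alpha> - \<beta> \<in> \<Gamma>"
  using \<Gamma>_add[of \<alpha> "- \<beta>"] by simp

lemma \<Gamma>_sum [intro]: "(\<And>x. x \<in> X \<Longrightarrow> f x \<in> \<Gamma>) \<Longrightarrow> sum f X \<in> \<Gamma>"
  by (induction X rule: infinite_finite_induct) auto

lemma \<Gamma>_lookup_bar: "\<alpha> \<in> \<Gamma> \<Longrightarrow> 1 \<le> p \<Longrightarrow> p \<le> n \<Longrightarrow> 5 \<le> block l p \<Longrightarrow> Poly_Mapping.lookup \<alpha> (p + n) = 0"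
proof -
  assume a: "\<alpha> \<in> \<Gamma>" "1 \<le> p" "p \<le> n" "5 \<le> block l p"
  then have "p + n \<in> bar l ` idx_I l 5 6 \<union> idx_J l 7 7"
    using block_range[of p] by (auto simp: idx_J_def bar_idx_I_iff)
  then show ?thesis using adm a by (auto simp: admissible_group_def)
qed

lemma sigma_mem [simp, intro]: "1 \<le> p \<Longrightarrow> p \<le> n \<Longrightarrow> sigma l p \<in> \<Gamma>"
proof -
  assume p: "1 \<le> p" "p \<le> n"
  show ?thesis
  proof (cases "block l p \<le> 4")
    case True
    then have "p \<in> idx_I l 1 4" using p block_range[of p] by (simp add: idx_I_iff)
    then show ?thesis using adm by (auto simp: admissible_group_def)
  next
    case False
    then show ?thesis using sigma_eq[OF p] by auto
  qed
qed

lemma unit_vector_mem: "1 \<le> p \<Longrightarrow> p \<le> n \<Longrightarrow> block l p \<in> {5, 6} \<Longrightarrow> Poly_Mapping.single p 1 \<in> \<Gamma>"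
proof -
  assume "1 \<le> p" "p \<le> n" "block l p \<in> {5, 6}"
  then have "p \<in> idx_I l 5 6" by (auto simp: idx_I_iff)
  then show ?thesis using adm by (simp add: admissible_group_def)
qed

lemma axis_vector:
  assumes "1 \<le> p" "p \<le> n" "block l p \<le> 4" "q \<in> {p, p + n}"
  obtains a where "a \<noteq> 0" "Poly_Mapping.single q a \<in> \<Gamma>"
proof -
  have "p \<in> idx_I l 1 4" using assms block_range[of p] by (simp add: idx_I_iff)
  then have "q \<in> idx_J l 1 4" using imageI[of p _ "bar l"] assms by (auto simp: idx_J_def bar_eq)
  then have "{Poly_Mapping.single q c |c. True} \<inter> \<Gamma> \<noteq> {0}"
    using adm by (simp add: admissible_group_def)
  moreover have "0 \<in> {Poly_Mapping.single q c |c. True} \<inter> \<Gamma>" by (force intro: exI[of _ 0])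
  ultimately obtain c where "Poly_Mapping.single q c \<in> \<Gamma>" "Poly_Mapping.single q c \<noteq> 0" by blast
  then show ?thesis using that[of c] by (metis single_zero)
qed

text \<open>The coordinates \<open>p\<close> for which the variable \<open>t\<^sub>p\<close> is present.\<close>
definition tvars :: "nat set" where
  "tvars = idx_all l - (idx_J l 1 1 \<union> bar l ` idx_I l 2 3 \<union> idx_I l 5 5)"

lemma mindices_iff: "i \<in> mindices l \<longleftrightarrow> Poly_Mapping.keys i \<subseteq> tvars"
  by (auto simp: mindices_def tvars_def in_keys_iff)

lemma tvars_mem: "1 \<le> p \<Longrightarrow> p \<le> n \<Longrightarrow> block l p \<noteq> 1 \<Longrightarrow> block l p \<noteq> 5 \<Longrightarrow> p \<in> tvars"
  by (simp add: tvars_def idx_J_def idx_I_single bar_notin idx_all_def)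

lemma tvars_bar_mem: "1 \<le> p \<Longrightarrow> p \<le> n \<Longrightarrow> 4 \<le> block l p \<Longrightarrow> p + n \<in> tvars"
  by (auto simp: tvars_def idx_J_def idx_I_single bar_idx_I_iff idx_all_def)

end

context hamiltonian
begin

section \<open>The Hamiltonian algebra as a Poisson algebra\<close>

lemma mindices_0 [simp, intro]: "0 \<in> mindices l"
  by (simp add: mindices_iff)

lemma mindices_add [intro]: "i \<in> mindices l \<Longrightarrow> j \<in> mindices l \<Longrightarrow> i + j \<in> mindices l"
  using keys_add[of i j] by (auto simp: mindices_iff)

lemma mindices_diff [intro]: "i \<in> mindices l \<Longrightarrow> i - Poly_Mapping.single p 1 \<in> mindices l"
  by (auto simp: mindices_iff in_keys_iff lookup_minus subset_iff)

lemma mindices_single [intro]: "q \<in> tvars \<Longrightarrow> Poly_Mapping.single q k \<in> mindices l"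
  by (simp add: mindices_iff)

lemma single_mem [intro]: "\<alpha> \<in> \<Gamma> \<Longrightarrow> i \<in> mindices l \<Longrightarrow> Poly_Mapping.single (\<alpha>, i) c \<in> A"
  by (auto simp: ham_carrier_def)

lemma xpow_mem [intro, simp]: "\<alpha> \<in> \<Gamma> \<Longrightarrow> xpow \<alpha> \<in> A"
  unfolding xpow_def by (intro single_mem) auto

lemma A_add: "u \<in> A \<Longrightarrow> v \<in> A \<Longrightarrow> u + v \<in> A"
  using keys_add[of u v] by (auto simp: ham_carrier_def)

lemma A_0: "0 \<in> A"
  by (simp add: ham_carrier_def)

lemma A_minus: "u \<in> A \<Longrightarrow> - u \<in> A"
  by (simp add: ham_carrier_def in_keys_iff subset_iff)

lemma A_mult: "u \<in> A \<Longrightarrow> v \<in> A \<Longrightarrow> u * v \<in> A"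
  using keys_mult[of u v] by (auto simp: ham_carrier_def) blast+

lemma A_sum: "(\<And>x. x \<in> X \<Longrightarrow> f x \<in> A) \<Longrightarrow> sum f X \<in> A"
  by (induction X rule: infinite_finite_induct) (auto intro: A_add A_0)

lemma C_mem: "C c \<in> A"
  by (auto simp: ham_carrier_def zero_prod_def)

lemma A_induct [consumes 1, case_names single add]:
  assumes "u \<in> A"
    and "\<And>\<alpha> i c. \<alpha> \<in> \<Gamma> \<Longrightarrow> i \<in> mindices l \<Longrightarrow> P (Poly_Mapping.single (\<alpha>, i) c)"
    and "\<And>f g. f \<in> A \<Longrightarrow> g \<in> A \<Longrightarrow> P f \<Longrightarrow> P g \<Longrightarrow> P (f + g)"
  shows "P u"
proof -
  have "Poly_Mapping.keys u \<subseteq> \<Gamma> \<times> mindices l" using assms(1) by (simp add: ham_carrier_def)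
  then show ?thesis
  proof (induction u rule: keys_induct)
    case (single k c)
    then show ?case using assms(2)[of "fst k" "snd k" c] assms(2)[of 0 0 0] by auto
  next
    case (add f g)
    then show ?case using assms(3) by (simp add: ham_carrier_def)
  qed
qed

lemma d_full_mem: "u \<in> A \<Longrightarrow> d_full p u \<in> A"
proof (induction u rule: A_induct)
  case (single \<alpha> i c)
  then show ?case unfolding d_full_single by (intro A_add single_mem mindices_diff)
next
  case (add f g)
  then show ?case by (simp add: d_full_add A_add)
qed

lemma br_mem: "u \<in> A \<Longrightarrow> v \<in> A \<Longrightarrow> br u v \<in> A"
  unfolding br_eq diff_conv_add_uminus
  by (intro A_sum A_mult A_add A_minus d_full_mem xpow_mem sigma_mem) auto

sublocale poisson_subring A br C
proof
  show "C 1 = 1" by simp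
qed (auto simp: A_add A_mult br_mem C_mem single_add mult_single ham_bracket_add_right
    ham_bracket_self ham_bracket_mult_right ham_bracket_const intro: ham_bracket_skew)

lemma xpow_inverse: "xpow \<alpha> * xpow (- \<alpha>) = (1 :: 'a alg)"
  by (simp add: xpow_mult)

text \<open>If only one partial derivative of \<open>u\<close> is nonzero, so is only one term of the bracket.\<close>
lemma br_one_derivative:
  assumes p: "1 \<le> p" "p \<le> n" and u: "\<And>q. q \<noteq> p \<Longrightarrow> d_full q u = 0"
  shows "br u v = xpow (sigma l p) * d_full p u * d_full (p + n) v"
proof -
  have "br u v = (\<Sum>q\<in>{1..n}. if q = p then xpow (sigma l p) * d_full p u * d_full (p + n) v else 0)"
    unfolding br_eq
  proof (intro sum.cong refl)
    fix q assume "q \<in> {1..n}"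
    then have "q + n \<noteq> p" using p by auto
    then show "xpow (sigma l q) * (d_full q u * d_full (q + n) v - d_full (q + n) u * d_full q v) =
        (if q = p then xpow (sigma l p) * d_full p u * d_full (p + n) v else 0)"
      using u[of "q + n"] u[of q] by (auto simp: mult.assoc)
  qed
  then show ?thesis using p by simp
qed

lemma br_one_derivative_bar:
  assumes p: "1 \<le> p" "p \<le> n" and u: "\<And>q. q \<noteq> p + n \<Longrightarrow> d_full q u = 0"
  shows "br u v = - (xpow (sigma l p) * d_full (p + n) u * d_full p v)"
proof -
  have "br u v = (\<Sum>q\<in>{1..n}. if q = p then - (xpow (sigma l p) * d_full (p + n) u * d_full p v) else 0)"
    unfolding br_eq
  proof (intro sum.cong refl)
    fix q assume "q \<in> {1..n}"
    then have "q \<noteq> p + n" using p by auto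
    then show "xpow (sigma l q) * (d_full q u * d_full (q + n) v - d_full (q + n) u * d_full q v) =
        (if q = p then - (xpow (sigma l p) * d_full (p + n) u * d_full p v) else 0)"
      using u[of "q + n"] u[of q] by (auto simp: mult.assoc)
  qed
  then show ?thesis using p by simp
qed

lemma d_full_xpow_axis: "d_full q (xpow (Poly_Mapping.single r a)) =
    (if q = r then C a * xpow (Poly_Mapping.single r a) else 0)"
  by (simp add: d_full_xpow lookup_single)

lemma d_full_tvar: "d_full q (Poly_Mapping.single (0, Poly_Mapping.single r 1) 1 :: 'a alg) = (if q = r then 1 else 0)"
  by (simp add: d_full_single lookup_single flip: zero_prod_def)

text \<open>
  Up to a unit every \<open>\<partial>\<^sub>q\<close> is inner: \<open>u\<close> is a function of the coordinate conjugate to \<open>q\<close> alone, namely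
  \<open>x\<^sup>\<alpha>\<close> for a vector \<open>\<alpha> \<in> \<Gamma>\<close> on the axis of that coordinate if there is one, and the
  corresponding variable \<open>t\<close> otherwise.
\<close>
lemma derivative_inner:
  assumes q: "1 \<le> q" "q \<le> 2 * n"
  obtains u e e' where "u \<in> A" "e \<in> A" "e' \<in> A" "e * e' = 1" "\<And>v. br u v = e * d_full q v"
proof -
  define p where "p = (if q \<le> n then q else q - n)"
  have p: "1 \<le> p" "p \<le> n" and q_cases: "q = p \<or> q = p + n" using q by (auto simp: p_def)
  have unit: "e * e' = 1" if "e = C a * xpow \<alpha>" "e' = C (inverse a) * xpow (- \<alpha>)" "a \<noteq> 0"
    for e e' :: "'a alg" and a \<alpha>
  proof -
    have "e * e' = C (a * inverse a) * (xpow \<alpha> * xpow (- \<alpha>))" by (simp only: that C_mult ac_simps)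
    then show ?thesis using that(3) by (simp add: xpow_inverse)
  qed
  show ?thesis
  proof (cases "block l p \<le> 4")
    case True
    show ?thesis
    proof (cases "q = p")
      case eq: True
      obtain a where a: "a \<noteq> 0" "Poly_Mapping.single (p + n) a \<in> \<Gamma>"
        using axis_vector[OF p True, of "p + n"] by auto
      define \<alpha> where "\<alpha> = sigma l p + Poly_Mapping.single (p + n) a"
      have \<alpha>: "\<alpha> \<in> \<Gamma>" unfolding \<alpha>_def using a p by (intro \<Gamma>_add sigma_mem)
      have "br (xpow (Poly_Mapping.single (p + n) a)) v = C (- a) * xpow \<alpha> * d_full q v" for v
        by (subst br_one_derivative_bar[OF p])
          (simp_all add: d_full_xpow_axis eq \<alpha>_def C_minus ac_simps flip: xpow_mult)
      then show ?thesis using that[of "xpow (Poly_Mapping.single (p + n) a)"] a \<alpha>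
          unit[OF refl refl, of "- a" \<alpha>] by (metis C_closed \<Gamma>_minus mult_closed neg_equal_0_iff_equal xpow_mem)
    next
      case False
      then have eq: "q = p + n" using q_cases by simp
      obtain a where a: "a \<noteq> 0" "Poly_Mapping.single p a \<in> \<Gamma>"
        using axis_vector[OF p True, of p] by auto
      define \<alpha> where "\<alpha> = sigma l p + Poly_Mapping.single p a"
      have \<alpha>: "\<alpha> \<in> \<Gamma>" unfolding \<alpha>_def using a p by (intro \<Gamma>_add sigma_mem)
      have "br (xpow (Poly_Mapping.single p a)) v = C a * xpow \<alpha> * d_full q v" for v
        by (subst br_one_derivative[OF p])
          (simp_all add: d_full_xpow_axis eq \<alpha>_def ac_simps flip: xpow_mult)
      then show ?thesis using that[of "xpow (Poly_Mapping.single p a)"] a \<alpha>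
          unit[OF refl refl, of a \<alpha>] by (metis C_closed \<Gamma>_minus mult_closed xpow_mem)
    qed
  next
    case False
    then have b: "block l p \<in> {5, 6, 7}" using block_range[OF p] by auto
    then have \<sigma>: "(sigma l p :: 'a vec) = 0" using sigma_eq[OF p] by auto
    show ?thesis
    proof (cases "q = p")
      case eq: True
      define u :: "'a alg" where "u = Poly_Mapping.single (0, Poly_Mapping.single (p + n) 1) 1"
      have "u \<in> A" unfolding u_def using tvars_bar_mem[OF p] b by (intro single_mem mindices_single) auto
      moreover have "br u v = - 1 * d_full q v" for v
        by (subst br_one_derivative_bar[OF p]) (simp_all add: u_def d_full_tvar[unfolded One_nat_def] \<sigma> eq)
      ultimately show ?thesis using that[of u "- 1" "- 1"] by simp
    next
      case False
      then have eq: "q = p + n" using q_cases by simp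
      show ?thesis
      proof (cases "block l p = 7")
        case True
        define u :: "'a alg" where "u = Poly_Mapping.single (0, Poly_Mapping.single p 1) 1"
        have "u \<in> A" unfolding u_def using tvars_mem[OF p] True by (intro single_mem mindices_single) auto
        moreover have "br u v = 1 * d_full q v" for v
          by (subst br_one_derivative[OF p]) (simp_all add: u_def d_full_tvar[unfolded One_nat_def] \<sigma> eq)
        ultimately show ?thesis using that[of u 1 1] by simp
      next
        case False
        define u :: "'a alg" where "u = xpow (Poly_Mapping.single p 1)"
        have \<alpha>: "Poly_Mapping.single p 1 \<in> \<Gamma>" using unit_vector_mem[OF p] False b by auto
        have "br u v = u * d_full q v" for v
          by (subst br_one_derivative[OF p]) (simp_all add: u_def d_full_xpow_axis \<sigma> eq)
        then show ?thesis using that[of u u "xpow (- Poly_Mapping.single p 1)"] \<alpha>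
          by (simp add: u_def xpow_inverse)
      qed
    qed
  qed
qed

text \<open>
  Read as a recursion in the exponent of \<open>t\<^sub>q\<close>, this controls the kernel of \<open>\<partial>\<^sub>q\<close>.
\<close>
lemma lookup_d_full: "Poly_Mapping.lookup (d_full q u) (\<alpha>, i) =
    Poly_Mapping.lookup \<alpha> q * Poly_Mapping.lookup u (\<alpha>, i) +
    of_nat (Poly_Mapping.lookup i q + 1) * Poly_Mapping.lookup u (\<alpha>, i + Poly_Mapping.single q 1)"
proof -
  have "Poly_Mapping.keys u \<subseteq> UNIV" by simp
  then show ?thesis
  proof (induction u rule: keys_induct)
    case (single k c)
    obtain \<beta> j where k: "k = (\<beta>, j)" by fastforce
    have "(if j - Poly_Mapping.single q 1 = i then c * of_nat (Poly_Mapping.lookup j q) else 0) =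
        (if j = i + Poly_Mapping.single q 1 then c * of_nat (Poly_Mapping.lookup i q + 1) else 0)"
    proof (cases "j = i + Poly_Mapping.single q 1")
      case True
      then have "j - Poly_Mapping.single q 1 = i" by simp
      then show ?thesis using True by (simp add: lookup_add)
    next
      case False
      have "Poly_Mapping.lookup j q = 0" if "j - Poly_Mapping.single q 1 = i"
      proof (rule ccontr)
        assume "Poly_Mapping.lookup j q \<noteq> 0"
        then have "j = i + Poly_Mapping.single q 1"
          unfolding that[symmetric]
          by (intro poly_mapping_eqI) (auto simp: lookup_add lookup_minus lookup_single when_def)
        then show False using False by simp
      qed
      then show ?thesis using False by simp
    qed
    then show ?case unfolding k d_full_single
      by (auto simp: lookup_add lookup_single when_def)
  next
    case (add f g)
    then show ?case by (simp add: d_full_add lookup_add algebra_simps)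
  qed
qed

lemma scalar_if_derivatives_vanish:
  assumes z: "z \<in> A" and d: "\<And>q. 1 \<le> q \<Longrightarrow> q \<le> 2 * n \<Longrightarrow> d_full q z = 0"
  shows "z = C (Poly_Mapping.lookup z 0)"
proof -
  have rec: "Poly_Mapping.lookup \<alpha> q * Poly_Mapping.lookup z (\<alpha>, i) +
      of_nat (Poly_Mapping.lookup i q + 1) * Poly_Mapping.lookup z (\<alpha>, i + Poly_Mapping.single q 1) = 0"
    if "1 \<le> q" "q \<le> 2 * n" for q \<alpha> i
    using lookup_d_full[of q z \<alpha> i] d[OF that] by simp
  have "\<alpha> = 0 \<and> i = 0" if nz: "Poly_Mapping.lookup z (\<alpha>, i) \<noteq> 0" for \<alpha> i
  proof -
    have \<alpha>i: "\<alpha> \<in> \<Gamma>" "i \<in> mindices l"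
      using z nz by (auto simp: ham_carrier_def in_keys_iff)
    have 0: "Poly_Mapping.lookup \<alpha> q = 0" if q: "1 \<le> q" "q \<le> 2 * n" for q
    proof (rule ccontr)
      \<comment> \<open>otherwise the recursion produces nonzero coefficients at arbitrarily high powers of \<open>t\<^sub>q\<close>\<close>
      assume a: "Poly_Mapping.lookup \<alpha> q \<noteq> 0"
      have step: "Poly_Mapping.lookup z (\<alpha>, i + Poly_Mapping.single q k) \<noteq> 0" for k
      proof (induction k)
        case (Suc k)
        have "i + Poly_Mapping.single q k + Poly_Mapping.single q 1 = i + Poly_Mapping.single q (Suc k)"
          by (simp add: add.assoc flip: single_add)
        then show ?case using rec[OF q, of \<alpha> "i + Poly_Mapping.single q k"] Suc a by auto
      qed (simp add: nz)
      have "inj (\<lambda>k. (\<alpha>, i + Poly_Mapping.single q k))"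
        by (intro injI) (auto, metis lookup_single_eq)
      then have "infinite (range (\<lambda>k. (\<alpha>, i + Poly_Mapping.single q k)))" by (rule range_inj_infinite)
      moreover have "range (\<lambda>k. (\<alpha>, i + Poly_Mapping.single q k)) \<subseteq> Poly_Mapping.keys z"
        using step by (auto simp: in_keys_iff)
      ultimately show False using finite_subset finite_keys by blast
    qed
    have "\<alpha> = 0"
      using 0 \<Gamma>_keys[OF \<alpha>i(1)] by (intro poly_mapping_eqI) (auto simp: in_keys_iff subset_iff)
    moreover have "Poly_Mapping.lookup i q = 0" for q
    proof (rule ccontr)
      assume q0: "Poly_Mapping.lookup i q \<noteq> 0"
      then have "q \<in> tvars" using \<alpha>i by (auto simp: mindices_iff in_keys_iff)
      then have q: "1 \<le> q" "q \<le> 2 * n" by (auto simp: tvars_def idx_all_def)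
      have "i - Poly_Mapping.single q 1 + Poly_Mapping.single q 1 = i"
        using q0 by (intro poly_mapping_eqI) (auto simp: lookup_add lookup_minus lookup_single when_def)
      then show False using rec[OF q, of \<alpha> "i - Poly_Mapping.single q 1"] nz 0[OF q]
        by (simp del: of_nat_Suc of_nat_add)
    qed
    ultimately show ?thesis by (auto intro: poly_mapping_eqI)
  qed
  then show ?thesis
    by (intro poly_mapping_eqI) (auto simp: lookup_single when_def zero_prod_def)
qed

lemma central_imp_scalar:
  assumes z: "z \<in> A" and central: "\<And>v. v \<in> A \<Longrightarrow> br v z = 0"
  shows "z = C (Poly_Mapping.lookup z 0)"
proof (rule scalar_if_derivatives_vanish[OF z])
  fix q assume "1 \<le> q" "q \<le> 2 * n"
  then obtain u e e' where u: "u \<in> A" "e \<in> A" "e' \<in> A" "e * e' = 1" "\<And>v. br u v = e * d_full q v"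
    using derivative_inner by metis
  then have "e' * (e * d_full q z) = 0" using central[of u] by simp
  moreover have "e' * (e * d_full q z) = (e * e') * d_full q z" by (simp only: ac_simps)
  ultimately show "d_full q z = 0" using u by simp
qed

section \<open>A polynomial variable makes an inner derivation surjective\<close>

text \<open>
  On the span of the \<open>x\<^sup>\<alpha> t\<^sup>i\<close> with fixed \<open>\<alpha>\<close>, \<open>\<partial>\<^sub>q\<close> is the sum of the scalar \<open>\<alpha>\<^sub>q\<close> and the locally
  nilpotent \<open>\<partial>/\<partial>t\<^sub>q\<close>. It is invertible if the scalar is nonzero; otherwise antiderivatives exist in
  characteristic \<open>0\<close>.
\<close>
lemma d_full_surjective:
  assumes q: "q \<in> tvars" and "y \<in> A"
  shows "\<exists>v\<in>A. d_full q v = y"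
  using assms(2)
proof (induction y rule: A_induct)
  case (single \<alpha> i c)
  show ?case
  proof (cases "Poly_Mapping.lookup \<alpha> q = 0")
    case True
    have "d_full q (Poly_Mapping.single (\<alpha>, i + Poly_Mapping.single q 1)
        (c / of_nat (Poly_Mapping.lookup i q + 1))) = Poly_Mapping.single (\<alpha>, i) c"
      unfolding d_full_single using True by (simp add: lookup_add del: of_nat_Suc of_nat_add)
    moreover have "Poly_Mapping.single (\<alpha>, i + Poly_Mapping.single q 1)
        (c / of_nat (Poly_Mapping.lookup i q + 1)) \<in> A"
      using single q by (intro single_mem mindices_add mindices_single)
    ultimately show ?thesis by blast
  next
    case False
    show ?thesis using single(2)
    proof (induction "Poly_Mapping.lookup i q" arbitrary: i c)
      case 0
      then have "d_full q (Poly_Mapping.single (\<alpha>, i) (c / Poly_Mapping.lookup \<alpha> q)) =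
          Poly_Mapping.single (\<alpha>, i) c"
        using False by (simp add: d_full_single)
      then show ?case using single(1) 0 by blast
    next
      case (Suc k)
      define i' where "i' = i - Poly_Mapping.single q 1"
      define d where "d = c / Poly_Mapping.lookup \<alpha> q * of_nat (Poly_Mapping.lookup i q)"
      have "i' \<in> mindices l" unfolding i'_def using Suc(3) by (rule mindices_diff)
      moreover have "k = Poly_Mapping.lookup i' q" using Suc(2) by (simp add: i'_def lookup_minus)
      ultimately obtain v where v: "v \<in> A" "d_full q v = Poly_Mapping.single (\<alpha>, i') (- d)"
        using Suc(1)[of i' "- d"] by blast
      have "d_full q (Poly_Mapping.single (\<alpha>, i) (c / Poly_Mapping.lookup \<alpha> q)) =
          Poly_Mapping.single (\<alpha>, i) c + Poly_Mapping.single (\<alpha>, i') d"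
        using False by (simp add: d_full_single i'_def d_def)
      then have "d_full q (Poly_Mapping.single (\<alpha>, i) (c / Poly_Mapping.lookup \<alpha> q) + v) =
          Poly_Mapping.single (\<alpha>, i) c"
        by (simp add: d_full_add v add.assoc flip: single_add)
      moreover have "Poly_Mapping.single (\<alpha>, i) (c / Poly_Mapping.lookup \<alpha> q) + v \<in> A"
        using single(1) Suc v by (intro A_add single_mem)
      ultimately show ?case by blast
    qed
  qed
next
  case (add f g)
  then obtain v w where "v \<in> A" "w \<in> A" "d_full q v = f" "d_full q w = g" by blast
  then show ?case by (intro bexI[of _ "v + w"]) (auto simp: d_full_add)
qed

lemma second_product_trivial_if_tvars:
  assumes "second_product A br C m" "tvars \<noteq> {}" "u \<in> A" "v \<in> A"
  shows "m u v = u * v"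
proof -
  interpret second_product A br C m by fact
  obtain q where q: "q \<in> tvars" using assms by blast
  then have "1 \<le> q" "q \<le> 2 * n" by (auto simp: tvars_def idx_all_def)
  then obtain x e e' where x: "x \<in> A" "e \<in> A" "e' \<in> A" "e * e' = 1" "\<And>v. br x v = e * d_full q v"
    using derivative_inner by metis
  have "\<exists>v\<in>A. br x v = y" if y: "y \<in> A" for y
  proof -
    obtain v where v: "v \<in> A" "d_full q v = e' * y"
      using d_full_surjective[OF q, of "e' * y"] x y by auto
    have "br x v = (e * e') * y" by (simp only: x(5) v(2) mult.assoc)
    then have "br x v = y" using x(4) by simp
    then show ?thesis using v by blast
  qed
  then have "T u v = 0" using T_eq_0_if_surjective x assms by blast
  then show ?thesis by (simp add: T_def)
qed

end

section \<open>Second products on a group algebra\<close>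

text \<open>
  The determinant of the projections to the plane of the coordinates \<open>p\<close> and \<open>p + k\<close>.
\<close>
definition wedge :: "nat \<Rightarrow> nat \<Rightarrow> 'a::comm_ring_1 vec \<Rightarrow> 'a vec \<Rightarrow> 'a" where
  "wedge k p \<alpha> \<beta> = Poly_Mapping.lookup \<alpha> p * Poly_Mapping.lookup \<beta> (p + k) -
    Poly_Mapping.lookup \<alpha> (p + k) * Poly_Mapping.lookup \<beta> p"

lemma wedge_add_right: "wedge k p \<alpha> (\<beta> + \<gamma>) = wedge k p \<alpha> \<beta> + wedge k p \<alpha> \<gamma>"
  and wedge_add_left: "wedge k p (\<alpha> + \<beta>) \<gamma> = wedge k p \<alpha> \<gamma> + wedge k p \<beta> \<gamma>"
  and wedge_diff_right: "wedge k p \<alpha> (\<beta> - \<gamma>) = wedge k p \<alpha> \<beta> - wedge k p \<alpha> \<gamma>"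
  and wedge_diff_left: "wedge k p (\<alpha> - \<beta>) \<gamma> = wedge k p \<alpha> \<gamma> - wedge k p \<beta> \<gamma>"
  and wedge_minus_right: "wedge k p \<alpha> (- \<gamma>) = - wedge k p \<alpha> \<gamma>"
  and wedge_minus_left: "wedge k p (- \<alpha>) \<gamma> = - wedge k p \<alpha> \<gamma>"
  and wedge_self [simp]: "wedge k p \<alpha> \<alpha> = 0"
  and wedge_zero [simp]: "wedge k p \<alpha> 0 = 0" "wedge k p 0 \<gamma> = 0"
  and wedge_swap: "wedge k p \<beta> \<alpha> = - wedge k p \<alpha> \<beta>"
  by (simp_all add: wedge_def lookup_add lookup_minus algebra_simps)

lemmas wedge_linear = wedge_add_right wedge_add_left wedge_diff_right wedge_diff_left
  wedge_minus_right wedge_minus_left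

text \<open>
  Without variables \<open>t\<close> only the first index block is nonempty, so that
  \<open>\<sigma>\<^sub>p = \<epsilon>\<^sub>p + \<epsilon>\<^bsub>p + n\<^esub>\<close> for all \<open>p\<close>, and the bracket of two monomials is a sum over the planes of
  conjugate coordinates.
\<close>
locale hamiltonian_group_algebra = hamiltonian l \<Gamma>
  for l and \<Gamma> :: "'a::field_char_0 vec set" +
  assumes no_tvars: "tvars = {}"
begin

abbreviation \<sigma> :: "nat \<Rightarrow> 'a vec" where "\<sigma> \<equiv> sigma l"

abbreviation w :: "nat \<Rightarrow> 'a vec \<Rightarrow> 'a vec \<Rightarrow> 'a" where "w \<equiv> wedge n"

lemma block_1: "1 \<le> p \<Longrightarrow> p \<le> n \<Longrightarrow> block l p = 1"
  using no_tvars tvars_mem[of p] tvars_bar_mem[of p] by (cases "block l p = 5") auto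

lemma sigma_group: "1 \<le> p \<Longrightarrow> p \<le> n \<Longrightarrow> \<sigma> p = Poly_Mapping.single p 1 + Poly_Mapping.single (p + n) 1"
  using sigma_eq[of p] by (simp add: block_1)

lemma lookup_sigma:
  assumes "1 \<le> p" "p \<le> n" "1 \<le> q" "q \<le> n"
  shows "Poly_Mapping.lookup (\<sigma> p) q = (if q = p then 1 else 0)"
    and "Poly_Mapping.lookup (\<sigma> p) (q + n) = (if q = p then 1 else 0)"
  using assms by (auto simp: sigma_group lookup_add lookup_single when_def)

lemma mindices_trivial: "i \<in> mindices l \<Longrightarrow> i = 0"
  by (simp add: mindices_iff no_tvars)

lemma A_induct_xpow [consumes 1, case_names xpow add]:
  assumes "u \<in> A" and "\<And>\<alpha> c. \<alpha> \<in> \<Gamma> \<Longrightarrow> P (C c * xpow \<alpha>)"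
    and "\<And>f g. f \<in> A \<Longrightarrow> g \<in> A \<Longrightarrow> P f \<Longrightarrow> P g \<Longrightarrow> P (f + g)"
  shows "P u"
  using assms(1)
proof (induction u rule: A_induct)
  case (single \<alpha> i c)
  then show ?case using assms(2)[of \<alpha> c] by (simp add: mindices_trivial[OF single(2)] xpow_def mult_single)
qed (use assms(3) in auto)

lemma br_xpow: "br (xpow \<alpha>) (xpow \<beta>) = (\<Sum>p\<in>{1..n}. C (w p \<alpha> \<beta>) * xpow (\<sigma> p + \<alpha> + \<beta>))"
  unfolding br_eq
proof (intro sum.cong refl)
  fix p
  have "xpow (\<sigma> p) * (d_full p (xpow \<alpha>) * d_full (p + n) (xpow \<beta>) - d_full (p + n) (xpow \<alpha>) * d_full p (xpow \<beta>))
      = (C (Poly_Mapping.lookup \<alpha> p) * C (Poly_Mapping.lookup \<beta> (p + n)) -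
        C (Poly_Mapping.lookup \<alpha> (p + n)) * C (Poly_Mapping.lookup \<beta> p)) *
        (xpow (\<sigma> p) * xpow \<alpha> * xpow \<beta>)"
    unfolding d_full_xpow by (simp only: algebra_simps)
  then show "xpow (\<sigma> p) * (d_full p (xpow \<alpha>) * d_full (p + n) (xpow \<beta>) - d_full (p + n) (xpow \<alpha>) * d_full p (xpow \<beta>))
      = C (w p \<alpha> \<beta>) * xpow (\<sigma> p + \<alpha> + \<beta>)"
    by (simp add: wedge_def xpow_mult single_diff mult_single)
qed

definition plane :: "nat \<Rightarrow> 'a vec set" where
  "plane p = {\<alpha> \<in> \<Gamma>. \<forall>q. q \<noteq> p \<longrightarrow> q \<noteq> p + n \<longrightarrow> Poly_Mapping.lookup \<alpha> q = 0}"

definition nonzero_at :: "nat \<Rightarrow> 'a vec \<Rightarrow> bool" where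
  "nonzero_at p \<delta> \<longleftrightarrow> Poly_Mapping.lookup \<delta> p \<noteq> 0 \<or> Poly_Mapping.lookup \<delta> (p + n) \<noteq> 0"

lemma nonzero_atI: "w p \<alpha> \<delta> \<noteq> 0 \<Longrightarrow> nonzero_at p \<delta>"
  by (auto simp: nonzero_at_def wedge_def)

lemma plane_\<Gamma>: "\<alpha> \<in> plane p \<Longrightarrow> \<alpha> \<in> \<Gamma>"
  by (simp add: plane_def)

lemma plane_add: "\<alpha> \<in> plane p \<Longrightarrow> \<beta> \<in> plane p \<Longrightarrow> \<alpha> + \<beta> \<in> plane p"
  and plane_diff: "\<alpha> \<in> plane p \<Longrightarrow> \<beta> \<in> plane p \<Longrightarrow> \<alpha> - \<beta> \<in> plane p"
  and plane_minus: "\<alpha> \<in> plane p \<Longrightarrow> - \<alpha> \<in> plane p"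
  by (auto simp: plane_def lookup_add lookup_minus)

lemma sigma_plane: "1 \<le> p \<Longrightarrow> p \<le> n \<Longrightarrow> \<sigma> p \<in> plane p"
  using sigma_mem[of p] by (auto simp: plane_def sigma_group lookup_add lookup_single when_def)

lemma wedge_plane:
  assumes "1 \<le> p" "p \<le> n" "1 \<le> q" "q \<le> n" "p \<noteq> q" "\<alpha> \<in> plane p"
  shows "w q \<alpha> \<beta> = 0" "w q \<beta> \<alpha> = 0"
  using assms by (auto simp: plane_def wedge_def)

lemma wedge_sigma:
  assumes "1 \<le> p" "p \<le> n" "1 \<le> q" "q \<le> n" "p \<noteq> q"
  shows "w q \<alpha> (\<sigma> p) = 0"
  using wedge_plane[OF assms sigma_plane] assms by simp

lemma br_plane:
  assumes p: "1 \<le> p" "p \<le> n" and \<alpha>: "\<alpha> \<in> plane p"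
  shows "br (xpow \<alpha>) (xpow \<beta>) = C (w p \<alpha> \<beta>) * xpow (\<sigma> p + \<alpha> + \<beta>)"
proof -
  have "br (xpow \<alpha>) (xpow \<beta>) = (\<Sum>q\<in>{1..n}. if q = p then C (w p \<alpha> \<beta>) * xpow (\<sigma> p + \<alpha> + \<beta>) else 0)"
    unfolding br_xpow using wedge_plane[OF p _ _ _ \<alpha>] by (intro sum.cong) auto
  then show ?thesis using p by simp
qed

lemma axis_plane:
  assumes "1 \<le> p" "p \<le> n" "q \<in> {p, p + n}"
  obtains a where "a \<noteq> 0" "Poly_Mapping.single q a \<in> plane p"
proof -
  obtain a where "a \<noteq> 0" "Poly_Mapping.single q a \<in> \<Gamma>"
    using axis_vector[of p q] assms block_1 by auto
  then show ?thesis using that[of a] assms by (auto simp: plane_def lookup_single when_def)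
qed

text \<open>
  Each \<open>\<delta>\<close> excludes a line through the origin, and finitely many of these do not cover the lattice of
  rank two that is spanned by vectors on the two axes.
\<close>
lemma plane_avoids_lines:
  assumes p: "1 \<le> p" "p \<le> n" and D: "finite D" "\<And>\<delta>. \<delta> \<in> D \<Longrightarrow> nonzero_at p \<delta>"
  obtains \<alpha> where "\<alpha> \<in> plane p" "\<And>\<delta>. \<delta> \<in> D \<Longrightarrow> w p \<alpha> \<delta> \<noteq> 0"
proof -
  obtain a where a: "a \<noteq> 0" "Poly_Mapping.single p a \<in> plane p" using axis_plane[OF p, of p] by auto
  obtain b where b: "b \<noteq> 0" "Poly_Mapping.single (p + n) b \<in> plane p"
    using axis_plane[OF p, of "p + n"] by auto
  have kb: "Poly_Mapping.single (p + n) (of_nat k * b) \<in> plane p" for k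
  proof (induction k)
    case 0
    show ?case by (simp add: plane_def)
  next
    case (Suc k)
    then show ?case using plane_add[OF b(2)] by (simp add: distrib_right single_add)
  qed
  define v where "v k = Poly_Mapping.single p a + Poly_Mapping.single (p + n) (of_nat k * b)" for k :: nat
  have v: "v k \<in> plane p" for k unfolding v_def by (intro plane_add a kb)
  have w: "w p (v k) \<delta> = a * Poly_Mapping.lookup \<delta> (p + n) - of_nat k * b * Poly_Mapping.lookup \<delta> p" for k \<delta>
    using p by (simp add: v_def wedge_def lookup_add lookup_single)
  have "finite {k. w p (v k) \<delta> = 0}" if "\<delta> \<in> D" for \<delta>
  proof (rule ccontr)
    assume inf: "infinite {k. w p (v k) \<delta> = 0}"
    then obtain k where k: "w p (v k) \<delta> = 0" using not_finite_existsD by blast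
    have "infinite ({k. w p (v k) \<delta> = 0} - {k})" using inf by simp
    then have "{k. w p (v k) \<delta> = 0} - {k} \<noteq> {}" by (metis finite.emptyI)
    then obtain k' where k': "w p (v k') \<delta> = 0" "k' \<noteq> k" by blast
    have "(of_nat k - of_nat k') * b * Poly_Mapping.lookup \<delta> p = 0"
      using k k' by (simp add: w algebra_simps)
    then have "Poly_Mapping.lookup \<delta> p = 0" using k'(2) b by simp
    then have "Poly_Mapping.lookup \<delta> (p + n) = 0" using k a by (simp add: w)
    then show False using \<open>Poly_Mapping.lookup \<delta> p = 0\<close> D(2)[OF that] by (simp add: nonzero_at_def)
  qed
  then have "finite (\<Union>\<delta>\<in>D. {k. w p (v k) \<delta> = 0})" using D by blast
  then obtain k where "k \<notin> (\<Union>\<delta>\<in>D. {k. w p (v k) \<delta> = 0})"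
    using ex_new_if_finite infinite_UNIV_nat by blast
  then show ?thesis using that[OF v[of k]] by auto
qed

lemma xpow_slice:
  assumes p: "1 \<le> p" "p \<le> n" and \<alpha>: "\<alpha> \<in> plane p" "w p \<alpha> (\<sigma> p) \<noteq> 0"
  obtains s where "s \<in> A" "br (xpow \<alpha>) s = 1"
proof -
  define s where "s = C (- inverse (w p \<alpha> (\<sigma> p))) * xpow (- \<alpha> - \<sigma> p)"
  have "s \<in> A" unfolding s_def using \<alpha> p by (intro mult_closed C_closed xpow_mem \<Gamma>_diff \<Gamma>_minus plane_\<Gamma> sigma_mem)
  moreover have "br (xpow \<alpha>) s = 1"
    unfolding s_def br_scale_right br_plane[OF p \<alpha>(1)]
    using \<alpha>(2) by (simp add: wedge_linear mult_single flip: mult.assoc)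
  ultimately show ?thesis using that by blast
qed

definition sigma_total :: "'a vec" where
  "sigma_total = (\<Sum>p\<in>{1..n}. \<sigma> p)"

lemma sigma_total_mem [simp]: "sigma_total \<in> \<Gamma>"
  unfolding sigma_total_def by (intro \<Gamma>_sum) auto

lemma lookup_sigma_total:
  assumes "1 \<le> q" "q \<le> n"
  shows "Poly_Mapping.lookup sigma_total q = 1" "Poly_Mapping.lookup sigma_total (q + n) = 1"
  using assms by (simp_all add: sigma_total_def lookup_sum lookup_sigma)

lemma wedge_sigma_total: "1 \<le> p \<Longrightarrow> p \<le> n \<Longrightarrow> w p \<alpha> sigma_total = w p \<alpha> (\<sigma> p)"
  by (simp add: wedge_def lookup_sigma_total lookup_sigma)

lemma \<Gamma>_eqI:
  assumes "\<alpha> \<in> \<Gamma>" "\<beta> \<in> \<Gamma>"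
    and "\<And>q. 1 \<le> q \<Longrightarrow> q \<le> n \<Longrightarrow> \<not> nonzero_at q (\<alpha> - \<beta>)"
  shows "\<alpha> = \<beta>"
proof (rule poly_mapping_eqI)
  fix q
  show "Poly_Mapping.lookup \<alpha> q = Poly_Mapping.lookup \<beta> q"
  proof (cases "1 \<le> q \<and> q \<le> 2 * n")
    case True
    show ?thesis
    proof (cases "q \<le> n")
      case False
      then have "1 \<le> q - n" "q - n \<le> n" "q - n + n = q" using True by auto
      then show ?thesis using assms(3)[of "q - n"] by (simp add: nonzero_at_def lookup_minus)
    qed (use assms(3)[of q] True in \<open>simp add: nonzero_at_def lookup_minus\<close>)
  next
    case False
    then have "q \<notin> Poly_Mapping.keys \<alpha>" "q \<notin> Poly_Mapping.keys \<beta>" using \<Gamma>_keys assms by fastforce+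
    then show ?thesis by (simp add: in_keys_iff)
  qed
qed

end

locale group_algebra_second_product = hamiltonian_group_algebra l \<Gamma> +
    second_product "ham_carrier l \<Gamma>" "ham_bracket l" "Poly_Mapping.single 0" m
  for l and \<Gamma> :: "'a::field_char_0 vec set" and m
begin

text \<open>
  Here \<open>x\<^sup>\<beta>\<close> is in the image of \<open>ad x\<^sup>\<alpha>\<close>.
\<close>
lemma T_xpow_generic:
  assumes p: "1 \<le> p" "p \<le> n" and \<alpha>: "\<alpha> \<in> plane p" "w p \<alpha> (\<sigma> p) \<noteq> 0"
    and \<beta>: "\<beta> \<in> \<Gamma>" "w p \<alpha> (\<beta> - \<sigma> p) \<noteq> 0"
  shows "T (xpow \<alpha>) (xpow \<beta>) = 0"
proof -
  have mem: "\<alpha> \<in> \<Gamma>" "\<beta> - \<alpha> - \<sigma> p \<in> \<Gamma>" using plane_\<Gamma>[OF \<alpha>(1)] \<beta>(1) p by auto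
  obtain s where s: "s \<in> A" "br (xpow \<alpha>) s = 1" using xpow_slice[OF p \<alpha>] .
  have "br (xpow \<alpha>) (xpow (\<beta> - \<alpha> - \<sigma> p)) = C (w p \<alpha> (\<beta> - \<sigma> p)) * xpow \<beta>"
    by (simp add: br_plane[OF p \<alpha>(1)] wedge_linear)
  then have "C (w p \<alpha> (\<beta> - \<sigma> p)) * T (xpow \<alpha>) (xpow \<beta>) = 0"
    using T_slice_image[of "xpow \<alpha>" s "xpow (\<beta> - \<alpha> - \<sigma> p)"] s mem \<beta>
      T_scale_right[of "xpow \<alpha>" "xpow \<beta>"] by simp
  then show ?thesis using C_cancel[OF \<beta>(2), of _ 0] by simp
qed

text \<open>
  If \<open>\<alpha>\<close> and \<open>\<beta> - \<sigma>\<^sub>p\<close> are parallel, write \<open>x\<^sup>\<alpha>\<close> as a bracket \<open>[x\<^sup>\<gamma>, x\<^sup>\<alpha>\<^sup>']\<close> with \<open>\<alpha>'\<close> in general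
  position and use the invariance of \<open>T x\<^sup>\<alpha>\<^sup>' x\<^sup>\<beta> = 0\<close>.
\<close>
lemma T_xpow_plane:
  assumes p: "1 \<le> p" "p \<le> n" and \<alpha>: "\<alpha> \<in> plane p" "w p \<alpha> (\<sigma> p) \<noteq> 0"
    and \<beta>: "\<beta> \<in> \<Gamma>" "nonzero_at p (\<beta> - \<sigma> p)" "nonzero_at p (\<alpha> + \<beta> - \<sigma> p)"
  shows "T (xpow \<alpha>) (xpow \<beta>) = 0"
proof -
  have "w p (\<sigma> p) (\<alpha> - \<sigma> p) \<noteq> 0"
    using \<alpha>(2) wedge_swap[of n p "\<sigma> p" \<alpha>] by (simp add: wedge_linear)
  then have \<sigma>: "nonzero_at p (\<sigma> p)" and "nonzero_at p (\<alpha> - \<sigma> p)"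
    using \<alpha>(2) nonzero_atI by blast+
  then obtain \<alpha>' where \<alpha>': "\<alpha>' \<in> plane p"
    and "\<And>\<delta>. \<delta> \<in> {\<beta> - \<sigma> p, \<alpha> + \<beta> - \<sigma> p, \<alpha> - \<sigma> p, \<sigma> p} \<Longrightarrow> w p \<alpha>' \<delta> \<noteq> 0"
    using plane_avoids_lines[OF p, of "{\<beta> - \<sigma> p, \<alpha> + \<beta> - \<sigma> p, \<alpha> - \<sigma> p, \<sigma> p}"] \<beta> \<sigma> by auto
  then have w: "w p \<alpha>' (\<beta> - \<sigma> p) \<noteq> 0" "w p \<alpha>' (\<alpha> + \<beta> - \<sigma> p) \<noteq> 0"
      "w p \<alpha>' (\<alpha> - \<sigma> p) \<noteq> 0" "w p \<alpha>' (\<sigma> p) \<noteq> 0" by auto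
  define \<gamma> where "\<gamma> = \<alpha> - \<alpha>' - \<sigma> p"
  have \<gamma>: "\<gamma> \<in> plane p" unfolding \<gamma>_def using \<alpha> \<alpha>' p by (intro plane_diff sigma_plane)
  note mem = plane_\<Gamma>[OF \<alpha>(1)] plane_\<Gamma>[OF \<alpha>'] plane_\<Gamma>[OF \<gamma>] \<beta>(1)
  have "T (xpow \<alpha>') (xpow \<beta>) = 0"
    using T_xpow_generic[OF p \<alpha>' _ \<beta>(1)] w by simp
  then have "T (br (xpow \<gamma>) (xpow \<alpha>')) (xpow \<beta>) + T (xpow \<alpha>') (br (xpow \<gamma>) (xpow \<beta>)) = 0"
    using br_T[of "xpow \<gamma>" "xpow \<alpha>'" "xpow \<beta>"] mem by simp
  moreover have "T (xpow \<alpha>') (br (xpow \<gamma>) (xpow \<beta>)) = 0"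
  proof -
    have "\<sigma> p + \<gamma> + \<beta> \<in> \<Gamma>" using mem p by auto
    moreover from this have "T (xpow \<alpha>') (xpow (\<sigma> p + \<gamma> + \<beta>)) = 0"
      using w(2) by (intro T_xpow_generic[OF p \<alpha>' w(4)]) (auto simp: \<gamma>_def wedge_linear)
    ultimately show ?thesis using mem by (simp add: br_plane[OF p \<gamma>] T_scale_right)
  qed
  moreover have "br (xpow \<gamma>) (xpow \<alpha>') = C (- w p \<alpha>' (\<alpha> - \<sigma> p)) * xpow \<alpha>"
  proof -
    have "w p \<gamma> \<alpha>' = - w p \<alpha>' (\<alpha> - \<sigma> p)" by (simp add: \<gamma>_def wedge_linear wedge_swap[of n p _ \<alpha>'])
    moreover have "\<sigma> p + \<gamma> + \<alpha>' = \<alpha>" by (simp add: \<gamma>_def)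
    ultimately show ?thesis using br_plane[OF p \<gamma>] by simp
  qed
  ultimately have "C (- w p \<alpha>' (\<alpha> - \<sigma> p)) * T (xpow \<alpha>) (xpow \<beta>) = 0"
    using mem by (simp add: T_scale_left)
  then show ?thesis using C_cancel[of "- w p \<alpha>' (\<alpha> - \<sigma> p)" _ 0] w(3) by simp
qed

lemma br_planes_commute:
  assumes p: "1 \<le> p" "p \<le> n" and \<alpha>: "\<alpha> \<in> plane p"
    and q: "1 \<le> q" "q \<le> n" "p \<noteq> q" and \<gamma>: "\<gamma> \<in> plane q"
  shows "br (xpow \<alpha>) (xpow \<gamma>) = 0"
    "br (xpow \<alpha>) (br (xpow \<gamma>) (xpow \<beta>)) = br (xpow \<gamma>) (br (xpow \<alpha>) (xpow \<beta>))"
proof -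
  have "w p \<alpha> \<gamma> = 0" "w p \<alpha> (\<sigma> q) = 0" "w q \<gamma> \<alpha> = 0" "w q \<gamma> (\<sigma> p) = 0"
    using wedge_plane[OF q(1,2) p _ \<gamma>] wedge_plane[OF p q(1,2) _ \<alpha>] wedge_sigma p q by auto
  then show "br (xpow \<alpha>) (xpow \<gamma>) = 0"
    "br (xpow \<alpha>) (br (xpow \<gamma>) (xpow \<beta>)) = br (xpow \<gamma>) (br (xpow \<alpha>) (xpow \<beta>))"
    by (simp_all add: br_plane[OF p \<alpha>] br_plane[OF q(1,2) \<gamma>] br_scale_right wedge_linear)
      (simp add: ac_simps)
qed

text \<open>
  For general \<open>\<beta>\<close> the monomial \<open>x\<^sup>\<beta>\<close> is in the image of \<open>(ad x\<^sup>\<gamma>)\<^sup>2\<close> for some \<open>\<gamma>\<close> in the plane \<open>q\<close>.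
  This fails only if \<open>\<beta>\<close> and \<open>2 \<sigma>\<^sub>q\<close> have the same projection; then \<open>x\<^sup>\<beta>\<close> is still in the image of
  \<open>ad x\<^sup>\<gamma>\<close>, and the preimage is covered by the general case.
\<close>
lemma T_xpow_other_plane:
  assumes p: "1 \<le> p" "p \<le> n" and \<alpha>: "\<alpha> \<in> plane p" "w p \<alpha> (\<sigma> p) \<noteq> 0"
    and q: "1 \<le> q" "q \<le> n" "p \<noteq> q" and \<beta>: "\<beta> \<in> \<Gamma>" "nonzero_at q (\<beta> - \<sigma> q)"
  shows "T (xpow \<alpha>) (xpow \<beta>) = 0"
proof -
  obtain s where s: "s \<in> A" "br (xpow \<alpha>) s = 1" using xpow_slice[OF p \<alpha>] .
  have "nonzero_at q (\<sigma> q)" using q by (simp add: nonzero_at_def lookup_sigma)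
  note nz = this \<beta>(2)
  have br_z: "br (xpow \<gamma>) (xpow (\<beta> - \<gamma> - \<sigma> q)) = C (w q \<gamma> (\<beta> - \<sigma> q)) * xpow \<beta>"
    if "\<gamma> \<in> plane q" for \<beta> \<gamma>
    by (simp add: br_plane[OF q(1,2) that] wedge_linear)
  have generic: "T (xpow \<alpha>) (xpow \<beta>) = 0"
    if \<beta>: "\<beta> \<in> \<Gamma>" "nonzero_at q (\<beta> - \<sigma> q)" "nonzero_at q (\<beta> - \<sigma> q - \<sigma> q)" for \<beta>
  proof -
    obtain \<gamma> where \<gamma>: "\<gamma> \<in> plane q"
      and "\<And>\<delta>. \<delta> \<in> {\<sigma> q, \<beta> - \<sigma> q, \<beta> - \<sigma> q - \<sigma> q} \<Longrightarrow> w q \<gamma> \<delta> \<noteq> 0"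
      using plane_avoids_lines[OF q(1,2), of "{\<sigma> q, \<beta> - \<sigma> q, \<beta> - \<sigma> q - \<sigma> q}"] \<beta> nz by auto
    then have w: "w q \<gamma> (\<sigma> q) \<noteq> 0" "w q \<gamma> (\<beta> - \<sigma> q) \<noteq> 0" "w q \<gamma> (\<beta> - \<sigma> q - \<sigma> q) \<noteq> 0" by auto
    obtain s' where s': "s' \<in> A" "br (xpow \<gamma>) s' = 1" using xpow_slice[OF q(1,2) \<gamma> w(1)] .
    define \<beta>' where "\<beta>' = \<beta> - \<gamma> - \<sigma> q"
    have "\<beta>' \<in> \<Gamma>" unfolding \<beta>'_def using plane_\<Gamma>[OF \<gamma>] \<beta>(1) q by auto
    then have mem: "\<alpha> \<in> \<Gamma>" "\<gamma> \<in> \<Gamma>" "\<beta>' \<in> \<Gamma>" "\<beta>' - \<gamma> - \<sigma> q \<in> \<Gamma>"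
      using plane_\<Gamma>[OF \<alpha>(1)] plane_\<Gamma>[OF \<gamma>] q by auto
    define c where "c = w q \<gamma> (\<beta>' - \<sigma> q) * w q \<gamma> (\<beta> - \<sigma> q)"
    have c: "c \<noteq> 0" using w by (simp add: c_def \<beta>'_def wedge_linear)
    have "br (xpow \<gamma>) (br (xpow \<gamma>) (xpow (\<beta>' - \<gamma> - \<sigma> q))) = C c * xpow \<beta>"
      using br_z[OF \<gamma>, of \<beta>'] br_z[OF \<gamma>, of \<beta>] by (simp add: br_scale_right c_def C_mult mult.assoc flip: \<beta>'_def)
    moreover have "T (xpow \<alpha>) (br (xpow \<gamma>) (br (xpow \<gamma>) (xpow (\<beta>' - \<gamma> - \<sigma> q)))) = 0"
      using T_slices_commute[OF _ _ _ s s'] br_planes_commute[OF p \<alpha>(1) q \<gamma>] mem by simp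
    ultimately have "C c * T (xpow \<alpha>) (xpow \<beta>) = 0" using mem \<beta> by (simp add: T_scale_right)
    then show ?thesis using C_cancel[OF c, of _ 0] by simp
  qed
  show ?thesis
  proof (cases "nonzero_at q (\<beta> - \<sigma> q - \<sigma> q)")
    case True
    then show ?thesis using generic \<beta> by blast
  next
    case False
    obtain \<gamma> where \<gamma>: "\<gamma> \<in> plane q" and "\<And>\<delta>. \<delta> \<in> {\<sigma> q, \<beta> - \<sigma> q} \<Longrightarrow> w q \<gamma> \<delta> \<noteq> 0"
      using plane_avoids_lines[OF q(1,2), of "{\<sigma> q, \<beta> - \<sigma> q}"] nz by auto
    then have w: "w q \<gamma> (\<sigma> q) \<noteq> 0" "w q \<gamma> (\<beta> - \<sigma> q) \<noteq> 0" by auto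
    define \<beta>' where "\<beta>' = \<beta> - \<gamma> - \<sigma> q"
    have mem: "\<alpha> \<in> \<Gamma>" "\<gamma> \<in> \<Gamma>" "\<beta>' \<in> \<Gamma>"
      unfolding \<beta>'_def using plane_\<Gamma>[OF \<alpha>(1)] plane_\<Gamma>[OF \<gamma>] \<beta>(1) q by auto
    have eq: "w q \<delta> \<beta> = w q \<delta> (\<sigma> q) + w q \<delta> (\<sigma> q)" for \<delta>
    proof -
      have "w q \<delta> (\<beta> - \<sigma> q - \<sigma> q) = 0" using False nonzero_atI by blast
      then show ?thesis by (simp only: wedge_diff_right) (simp add: algebra_simps)
    qed
    have "w q (\<sigma> q) \<gamma> \<noteq> 0" using w wedge_swap[of n q \<gamma>] by auto
    then have "w q (\<sigma> q) (\<beta>' - \<sigma> q) \<noteq> 0" "w q (\<sigma> q) (\<beta>' - \<sigma> q - \<sigma> q) \<noteq> 0"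
      by (simp_all only: \<beta>'_def wedge_diff_right eq wedge_self) simp_all
    then have "T (xpow \<alpha>) (xpow \<beta>') = 0" using generic mem nonzero_atI by blast
    then have "T (br (xpow \<gamma>) (xpow \<alpha>)) (xpow \<beta>') + T (xpow \<alpha>) (br (xpow \<gamma>) (xpow \<beta>')) = 0"
      using br_T[of "xpow \<gamma>" "xpow \<alpha>" "xpow \<beta>'"] mem by simp
    then have "C (w q \<gamma> (\<beta> - \<sigma> q)) * T (xpow \<alpha>) (xpow \<beta>) = 0"
      using br_planes_commute(1)[OF q(1,2) \<gamma> p q(3)[symmetric] \<alpha>(1)] br_z[OF \<gamma>, of \<beta>] mem \<beta>
      by (simp add: T_scale_right flip: \<beta>'_def)
    then show ?thesis using C_cancel[OF w(2), of _ 0] by simp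
  qed
qed


lemma T_xpow_nonexceptional:
  assumes p: "1 \<le> p" "p \<le> n" and \<alpha>: "\<alpha> \<in> plane p" "w p \<alpha> (\<sigma> p) \<noteq> 0"
    and \<beta>: "\<beta> \<in> \<Gamma>" "\<beta> \<noteq> sigma_total" "\<beta> \<noteq> sigma_total - \<alpha>"
  shows "T (xpow \<alpha>) (xpow \<beta>) = 0"
proof (rule ccontr)
  assume nz: "T (xpow \<alpha>) (xpow \<beta>) \<noteq> 0"
  have other: "\<not> nonzero_at q (\<beta> - \<sigma> q)" if "1 \<le> q" "q \<le> n" "q \<noteq> p" for q
    using T_xpow_other_plane[OF p \<alpha>] that \<beta>(1) nz by blast
  have total: "nonzero_at q (\<delta> - sigma_total) \<longleftrightarrow> nonzero_at q (\<delta> - \<sigma> q)" if "1 \<le> q" "q \<le> n" for q \<delta>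
    using that by (simp add: nonzero_at_def lookup_minus lookup_sigma_total lookup_sigma)
  have \<alpha>q: "nonzero_at q (\<alpha> + \<beta> - \<sigma> q) \<longleftrightarrow> nonzero_at q (\<beta> - \<sigma> q)" if "1 \<le> q" "q \<le> n" "q \<noteq> p" for q
    using that p \<alpha>(1) by (simp add: nonzero_at_def lookup_minus lookup_add plane_def)
  consider "\<not> nonzero_at p (\<beta> - \<sigma> p)" | "\<not> nonzero_at p (\<alpha> + \<beta> - \<sigma> p)"
    using T_xpow_plane[OF p \<alpha> \<beta>(1)] nz by blast
  then show False
  proof cases
    case 1
    then have "\<beta> = sigma_total"
      using other total \<beta>(1) by (intro \<Gamma>_eqI) (metis sigma_total_mem)+
    then show False using \<beta> by simp
  next
    case 2
    have "\<alpha> + \<beta> = sigma_total"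
    proof (rule \<Gamma>_eqI)
      show "\<not> nonzero_at q (\<alpha> + \<beta> - sigma_total)" if "1 \<le> q" "q \<le> n" for q
        using that 2 other total \<alpha>q by metis
    qed (use \<beta>(1) plane_\<Gamma>[OF \<alpha>(1)] in auto)
    then have "\<beta> = sigma_total - \<alpha>" by (simp add: algebra_simps)
    then show False using \<beta>(3) by simp
  qed
qed

text \<open>
  With \<open>u = x\<^sup>\<alpha>\<close> and \<open>v = x\<^sup>\<sigma>\<^sup>-\<^sup>\<alpha>\<close> compute \<open>u \<circ> (u \<circ> v) = u\<^sup>2 \<circ> v\<close>. The exponent of \<open>v\<close> is not
  exceptional for the monomial \<open>u\<^sup>2\<close>, so the right hand side is \<open>u\<^sup>2 v\<close>, which leaves \<open>u T u v = 0\<close>.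
\<close>
lemma T_xpow_exceptional:
  assumes p: "1 \<le> p" "p \<le> n" and \<alpha>: "\<alpha> \<in> plane p" "w p \<alpha> (\<sigma> p) \<noteq> 0"
    and total: "T (xpow \<alpha>) (xpow sigma_total) = 0"
  shows "T (xpow \<alpha>) (xpow (sigma_total - \<alpha>)) = 0"
proof -
  define u where "u = xpow \<alpha>"
  define v where "v = xpow (sigma_total - \<alpha>)"
  have mem: "\<alpha> \<in> \<Gamma>" using \<alpha>(1) by (rule plane_\<Gamma>)
  then have [simp]: "u \<in> A" "v \<in> A" by (simp_all add: u_def v_def)
  have \<alpha>0: "\<alpha> \<noteq> 0" using \<alpha> by auto
  obtain s where s: "s \<in> A" "br u s = 1" using xpow_slice[OF p \<alpha>] unfolding u_def .
  have uv: "u * v = xpow sigma_total" by (simp add: u_def v_def xpow_mult)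
  have "br u (T u v) = T u (br u v)" by (simp add: br_T)
  then have "br u (T u v) = 0" using T_slice_image[of u s v] s by simp
  then have 1: "T u (T u v) = 0" using T_slice_centralizer[of u s "T u v"] s by simp
  have "T u u = 0" using T_slice_centralizer[of u s u] s by simp
  moreover have "T (u * u) v = 0"
  proof -
    have "\<alpha> + \<alpha> \<in> plane p" using \<alpha>(1) \<alpha>(1) by (rule plane_add)
    moreover have "w p (\<alpha> + \<alpha>) (\<sigma> p) \<noteq> 0" unfolding wedge_add_left using \<alpha>(2) by simp
    moreover have "sigma_total - \<alpha> \<noteq> sigma_total - (\<alpha> + \<alpha>)" using \<alpha>0 by (simp add: algebra_simps del: mult_2)
    ultimately show ?thesis
      using T_xpow_nonexceptional[OF p, of "\<alpha> + \<alpha>" "sigma_total - \<alpha>"] mem \<alpha>0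
      by (simp add: u_def v_def xpow_mult)
  qed
  ultimately have "m u (m u v) = u * u * v"
    using m_assoc[of u u v] by (simp add: T_def)
  moreover have "m u (m u v) = u * (u * v) + u * T u v"
  proof -
    have "m u (m u v) = m u (u * v) + m u (T u v)"
      using m_add_right[of u "u * v" "T u v"] by (simp add: T_def)
    moreover have "m u (u * v) = u * (u * v)" using total unfolding uv by (simp add: T_def u_def)
    moreover have "m u (T u v) = u * T u v" using 1 by (simp add: T_def)
    ultimately show ?thesis by simp
  qed
  ultimately have "u * T u v = 0" by (simp add: mult.assoc)
  then have "xpow (- \<alpha>) * (u * T u v) = 0" by simp
  then show ?thesis by (simp add: u_def v_def xpow_mult flip: mult.assoc)
qed

text \<open>
  For the exponent \<open>\<sigma>\<close> the defect need not vanish, but dividing it by \<open>x\<^sup>\<alpha>\<close> yields an element killed by \<open>ad x\<^sup>\<alpha>\<close>, by \<open>ad x\<^sup>-\<^sup>\<sigma>\<^sup>p\<close> and by the \<open>ad x\<^sup>\<gamma>\<close> with \<open>\<gamma>\<close> on an axis of another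
  plane, and these are enough to force all partial derivatives to vanish.
\<close>
lemma T_xpow_sigma_total:
  assumes p: "1 \<le> p" "p \<le> n" and \<alpha>: "\<alpha> \<in> plane p" "w p \<alpha> (\<sigma> p) \<noteq> 0"
  obtains c where "T (xpow \<alpha>) (xpow sigma_total) = C c * xpow \<alpha>"
proof -
  define g where "g = T (xpow \<alpha>) (xpow sigma_total)"
  define y where "y = xpow (- \<alpha>) * g"
  have mem: "\<alpha> \<in> \<Gamma>" using \<alpha>(1) by (rule plane_\<Gamma>)
  then have [simp]: "g \<in> A" "y \<in> A" by (auto simp: g_def y_def)
  obtain s where s: "s \<in> A" "br (xpow \<alpha>) s = 1" using xpow_slice[OF p \<alpha>] .
  have unit: "z = 0" if "C a * xpow \<gamma> * z = 0" "a \<noteq> 0" for a \<gamma> and z :: "'a alg"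
  proof -
    have "xpow (- \<gamma>) * (xpow \<gamma> * z) = 0"
      using C_cancel[OF that(2), of "xpow \<gamma> * z" 0] that(1) by (simp add: mult.assoc)
    then show ?thesis by (simp add: xpow_mult flip: mult.assoc)
  qed
  have inner: "br z y = C (- c) * y + xpow (- \<alpha>) * br z g" if "br z (xpow \<alpha>) = C c * xpow \<alpha>" for z c
  proof -
    have "br z (xpow \<alpha> * xpow (- \<alpha>)) = 0" by (simp only: xpow_inverse br_1)
    then have "xpow \<alpha> * (br z (xpow (- \<alpha>)) + C c * xpow (- \<alpha>)) = 0"
      by (simp add: br_mult_right that algebra_simps)
    then have "C 1 * xpow \<alpha> * (br z (xpow (- \<alpha>)) + C c * xpow (- \<alpha>)) = 0" by simp
    then have "br z (xpow (- \<alpha>)) + C c * xpow (- \<alpha>) = 0" using unit one_neq_zero by blast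
    then have "br z (xpow (- \<alpha>)) = C (- c) * xpow (- \<alpha>)" by (simp add: C_minus eq_neg_iff_add_eq_0)
    then show ?thesis by (simp add: y_def br_mult_right mult.assoc)
  qed
  \<comment> \<open>\<open>ad x\<^sup>\<gamma>\<close> sends \<open>x\<^sup>\<sigma>\<close> to a multiple of a monomial whose exponent is not exceptional\<close>
  have other: "br (xpow \<gamma>) y = 0"
    if q: "1 \<le> q" "q \<le> n" "q \<noteq> p" and \<gamma>: "\<gamma> \<in> plane q" "\<sigma> q + \<gamma> \<noteq> 0" for q \<gamma>
  proof -
    note \<gamma>\<Gamma> = plane_\<Gamma>[OF \<gamma>(1)]
    have comm: "br (xpow \<gamma>) (xpow \<alpha>) = 0" using br_planes_commute(1)[OF q(1,2) \<gamma>(1) p q(3) \<alpha>(1)] .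
    have "\<sigma> q + \<gamma> + \<alpha> \<noteq> 0"
    proof
      assume "\<sigma> q + \<gamma> + \<alpha> = 0"
      then have "w p (\<sigma> q + \<gamma> + \<alpha>) (\<sigma> p) = 0" by simp
      then show False using \<alpha>(2) wedge_plane(1)[OF q(1,2) p q(3)] sigma_plane[OF q(1,2)] \<gamma>(1)
        by (simp add: wedge_linear)
    qed
    then have "\<sigma> q + \<gamma> + sigma_total \<noteq> sigma_total - \<alpha>" by (simp add: algebra_simps)
    moreover have "\<sigma> q + \<gamma> + sigma_total \<noteq> sigma_total" using \<gamma>(2) by simp
    ultimately have "T (xpow \<alpha>) (xpow (\<sigma> q + \<gamma> + sigma_total)) = 0"
      using T_xpow_nonexceptional[OF p \<alpha>] \<gamma>\<Gamma> q by simp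
    then have "br (xpow \<gamma>) g = 0"
      using mem \<gamma>\<Gamma> q br_plane[OF q(1,2) \<gamma>(1), of sigma_total]
      by (simp add: g_def br_T comm T_scale_right)
    then show ?thesis using inner[of "xpow \<gamma>" 0] comm by simp
  qed
  have d_other: "d_full q y = 0" "d_full (q + n) y = 0" if q: "1 \<le> q" "q \<le> n" "q \<noteq> p" for q
  proof -
    obtain a where a: "a \<noteq> 0" "Poly_Mapping.single q a \<in> plane q" using axis_plane[OF q(1,2), of q] by auto
    obtain b where b: "b \<noteq> 0" "Poly_Mapping.single (q + n) b \<in> plane q"
      using axis_plane[OF q(1,2), of "q + n"] by auto
    have "Poly_Mapping.lookup (\<sigma> q + Poly_Mapping.single q a) (q + n) = 1"
      "Poly_Mapping.lookup (\<sigma> q + Poly_Mapping.single (q + n) b) q = 1"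
      using q by (simp_all add: lookup_add lookup_sigma lookup_single)
    then have nz: "\<sigma> q + Poly_Mapping.single q a \<noteq> 0" "\<sigma> q + Poly_Mapping.single (q + n) b \<noteq> 0"
      by (metis lookup_zero zero_neq_one)+
    have "C a * xpow (\<sigma> q + Poly_Mapping.single q a) * d_full (q + n) y = br (xpow (Poly_Mapping.single q a)) y"
      by (subst br_one_derivative[OF q(1,2)]) (simp_all add: d_full_xpow_axis ac_simps flip: xpow_mult)
    then show "d_full (q + n) y = 0" using other[OF q a(2) nz(1)] unit a(1) by metis
    have "C (- b) * xpow (\<sigma> q + Poly_Mapping.single (q + n) b) * d_full q y = br (xpow (Poly_Mapping.single (q + n) b)) y"
      by (subst br_one_derivative_bar[OF q(1,2)])
        (simp_all add: d_full_xpow_axis C_minus ac_simps flip: xpow_mult)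
    then show "d_full q y = 0" using other[OF q b(2) nz(2)] unit b(1) by (metis neg_equal_0_iff_equal)
  qed
  have br_p: "br (xpow \<gamma>) y =
      xpow (\<sigma> p + \<gamma>) * (C (Poly_Mapping.lookup \<gamma> p) * d_full (p + n) y - C (Poly_Mapping.lookup \<gamma> (p + n)) * d_full p y)" for \<gamma>
  proof -
    have "br (xpow \<gamma>) y = (\<Sum>q\<in>{1..n}. if q = p then xpow (\<sigma> p) * (d_full p (xpow \<gamma>) * d_full (p + n) y - d_full (p + n) (xpow \<gamma>) * d_full p y) else 0)"
      unfolding br_eq using d_other by (intro sum.cong) auto
    then show ?thesis using p by (simp add: d_full_xpow algebra_simps flip: xpow_mult)
  qed
  have 1: "C (Poly_Mapping.lookup \<alpha> p) * d_full (p + n) y - C (Poly_Mapping.lookup \<alpha> (p + n)) * d_full p y = 0"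
  proof -
    have "br (xpow \<alpha>) g = T (xpow \<alpha>) (br (xpow \<alpha>) (xpow sigma_total))" using mem by (simp add: g_def br_T)
    then have "br (xpow \<alpha>) g = 0" using T_slice_image[OF _ s(1) _ s(2)] mem by simp
    then have "br (xpow \<alpha>) y = 0" using inner[of "xpow \<alpha>" 0] by simp
    then have "C 1 * xpow (\<sigma> p + \<alpha>) * (C (Poly_Mapping.lookup \<alpha> p) * d_full (p + n) y -
        C (Poly_Mapping.lookup \<alpha> (p + n)) * d_full p y) = 0"
      unfolding br_p by (simp only: C_1 mult_1)
    then show ?thesis using unit one_neq_zero by blast
  qed
  have 2: "d_full (p + n) y = d_full p y"
  proof -
    let ?h = "xpow (- \<sigma> p)"
    have h: "- \<sigma> p \<in> plane p" using p by (intro plane_minus sigma_plane)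
    define c where "c = w p (- \<sigma> p) \<alpha>"
    have h\<alpha>: "br ?h (xpow \<alpha>) = C c * xpow \<alpha>"
      using br_plane[OF p h] by (simp add: c_def)
    have "br ?h (xpow sigma_total) = 0"
      using p by (simp add: br_plane[OF p h] wedge_sigma_total wedge_linear)
    then have "br ?h g = C c * g"
      using mem plane_\<Gamma>[OF h] by (simp add: g_def br_T h\<alpha> T_scale_left)
    then have "br ?h y = 0" using inner[OF h\<alpha>] by (simp add: y_def C_minus ac_simps)
    then show ?thesis unfolding br_p using p by (simp add: lookup_sigma C_minus)
  qed
  have "C (w p \<alpha> (\<sigma> p)) * xpow 0 * d_full p y = 0"
    using 1 2 p by (simp add: wedge_def lookup_sigma single_diff algebra_simps)
  then have "d_full p y = 0" using unit \<alpha>(2) by blast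
  then have d_p: "d_full p y = 0" "d_full (p + n) y = 0" using 2 by simp_all
  have "d_full q y = 0" if q: "1 \<le> q" "q \<le> 2 * n" for q
  proof (cases "q \<le> n")
    case True
    then show ?thesis using q d_p d_other[of q] by (cases "q = p") auto
  next
    case False
    then have "1 \<le> q - n" "q - n \<le> n" "q - n + n = q" using q by auto
    then show ?thesis using d_p d_other(2)[of "q - n"] by (cases "q - n = p") auto
  qed
  then have "y = C (Poly_Mapping.lookup y 0)" by (rule scalar_if_derivatives_vanish[rotated]) auto
  then obtain c where c: "y = C c" by blast
  have "g = xpow \<alpha> * y" by (simp add: y_def xpow_mult flip: mult.assoc)
  then show ?thesis using that[of c] c by (simp add: g_def mult.commute)
qed

end

text \<open>
  If the second product is normalised at one monomial \<open>x\<^sup>\<alpha>\<close>, then \<open>T x\<^sup>\<alpha> = 0\<close>, and the ideal argument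
  applies with \<open>h = x\<^sup>-\<^sup>\<sigma>\<^sup>p\<close>.
\<close>
lemma (in group_algebra_second_product) T_eq_0_if_normalised:
  assumes p: "1 \<le> p" "p \<le> n" and \<alpha>: "\<alpha> \<in> plane p" "w p \<alpha> (\<sigma> p) \<noteq> 0"
    and total: "T (xpow \<alpha>) (xpow sigma_total) = 0" and uv: "u \<in> A" "v \<in> A"
  shows "T u v = 0"
proof -
  have mem: "\<alpha> \<in> \<Gamma>" using \<alpha>(1) by (rule plane_\<Gamma>)
  have mono: "T (xpow \<alpha>) (xpow \<beta>) = 0" if "\<beta> \<in> \<Gamma>" for \<beta>
    using T_xpow_nonexceptional[OF p \<alpha> that] T_xpow_exceptional[OF p \<alpha> total] total by metis
  have T\<alpha>: "T (xpow \<alpha>) x = 0" if "x \<in> A" for x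
    using that
    by (induction x rule: A_induct_xpow) (simp_all add: T_scale_right T_add_right mono mem)
  have h: "- \<sigma> p \<in> plane p" using p by (intro plane_minus sigma_plane)
  have "br (xpow (- \<sigma> p)) (xpow \<alpha>) = C (w p \<alpha> (\<sigma> p)) * xpow \<alpha>"
    using br_plane[OF p h, of \<alpha>] wedge_swap[of n p "\<sigma> p" \<alpha>] by (simp add: wedge_linear)
  then show ?thesis
    using T_eq_0_if_unit[of "xpow \<alpha>" "xpow (- \<alpha>)" "xpow (- \<sigma> p)" "w p \<alpha> (\<sigma> p)" u v]
      mem p \<alpha>(2) T\<alpha> uv xpow_inverse by simp
qed

context hamiltonian_group_algebra
begin

text \<open>
  The coefficient of \<open>x\<^sup>\<sigma>\<close>, \<open>\<sigma> = \<Sum>\<^sub>p \<sigma>\<^sub>p\<close>, is an invariant trace; it is the obstruction to an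
  arbitrary second product being equal to the given one.
\<close>
lemma trace_br:
  assumes "u \<in> A" "v \<in> A"
  shows "Poly_Mapping.lookup (br u v) (sigma_total, 0) = 0"
proof -
  have mono: "Poly_Mapping.lookup (br (xpow \<alpha>) (xpow \<beta>)) (sigma_total, 0) = 0" for \<alpha> \<beta>
    unfolding br_xpow lookup_sum
  proof (intro sum.neutral ballI)
    fix p assume "p \<in> {1..n}"
    then have p: "1 \<le> p" "p \<le> n" by auto
    have "w p \<alpha> \<beta> = 0" if "\<sigma> p + \<alpha> + \<beta> = sigma_total"
    proof -
      have "w p \<alpha> (\<sigma> p) = w p \<alpha> (\<sigma> p) + w p \<alpha> \<beta>"
        using wedge_sigma_total[OF p, of \<alpha>] by (simp add: wedge_linear flip: that)
      then show ?thesis by simp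
    qed
    then show "Poly_Mapping.lookup (C (w p \<alpha> \<beta>) * xpow (\<sigma> p + \<alpha> + \<beta>)) (sigma_total, 0) = 0"
      unfolding lookup_C_mult by (auto simp: xpow_def lookup_single when_def)
  qed
  have left: "Poly_Mapping.lookup (br (xpow \<alpha>) v) (sigma_total, 0) = 0" for \<alpha>
    using assms(2)
    by (induction v rule: A_induct_xpow) (simp_all add: br_scale_right br_add_right lookup_add lookup_C_mult mono)
  show ?thesis
    using assms(1)
    by (induction u rule: A_induct_xpow) (simp_all add: br_scale_left br_add_left lookup_add lookup_C_mult left)
qed

lemma group_algebra_second_product_isomorphic:
  assumes "second_product A br C m"
  obtains \<psi> where "bij_betw \<psi> A A" "\<And>u v. \<psi> (u + v) = \<psi> u + \<psi> v" "\<And>c u. \<psi> (C c * u) = C c * \<psi> u"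
    "\<And>u v. u \<in> A \<Longrightarrow> v \<in> A \<Longrightarrow> \<psi> (br u v) = br (\<psi> u) (\<psi> v)"
    "\<And>u v. u \<in> A \<Longrightarrow> v \<in> A \<Longrightarrow> \<psi> (m u v) = \<psi> u * \<psi> v"
proof -
  interpret M: second_product A br C m by fact
  interpret M: group_algebra_second_product l \<Gamma> m by unfold_locales
  obtain i where i: "i \<in> {1..7}" "l i \<noteq> 0" using datum by (auto simp: hamiltonian_datum_def)
  have "l i \<le> n" unfolding iota_def using i by (intro member_le_sum) auto
  then have p: "(1::nat) \<le> 1" "1 \<le> n" using i by auto
  have "nonzero_at 1 (\<sigma> 1)" using lookup_sigma[OF p p] by (simp add: nonzero_at_def)
  then obtain \<alpha> where \<alpha>: "\<alpha> \<in> plane 1" "w 1 \<alpha> (\<sigma> 1) \<noteq> 0"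
    using plane_avoids_lines[OF p, of "{\<sigma> 1}"] by auto
  then have mem: "\<alpha> \<in> \<Gamma>" by (intro plane_\<Gamma>)
  have \<alpha>0: "\<alpha> \<noteq> 0" using \<alpha> by auto
  have \<alpha>\<sigma>: "\<alpha> \<noteq> sigma_total" using \<alpha> wedge_sigma_total[OF p, of \<alpha>] by auto
  have \<sigma>0: "sigma_total \<noteq> 0" using lookup_sigma_total(1)[OF p] by (metis lookup_zero zero_neq_one)
  obtain c where c: "M.T (xpow \<alpha>) (xpow sigma_total) = C c * xpow \<alpha>" using M.T_xpow_sigma_total[OF p \<alpha>] .
  \<comment> \<open>conjugation by \<open>\<psi> = id + \<chi>\<close> changes \<open>T x\<^sup>\<alpha> x\<^sup>\<sigma>\<close> by \<open>- c x\<^sup>\<alpha>\<close>\<close>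
  define \<chi> where "\<chi> u = C (c * Poly_Mapping.lookup u (sigma_total, 0))" for u :: "'a alg"
  have \<chi>_add: "\<chi> (u + v) = \<chi> u + \<chi> v" and \<chi>_diff: "\<chi> (u - v) = \<chi> u - \<chi> v" for u v
    by (simp_all add: \<chi>_def lookup_add lookup_minus algebra_simps single_add single_diff)
  have \<chi>_scale: "\<chi> (C d * u) = C d * \<chi> u" for d u
    by (simp add: \<chi>_def lookup_C_mult mult_single mult.left_commute)
  have \<chi>_C: "\<chi> (C d) = 0" for d using \<sigma>0 by (simp add: \<chi>_def lookup_single zero_prod_def)
  have \<chi>_\<chi>: "\<chi> (\<chi> u) = 0" for u using \<chi>_C by (simp add: \<chi>_def)
  have \<chi>_br: "\<chi> (br u v) = 0" if "u \<in> A" "v \<in> A" for u v using trace_br[OF that] by (simp add: \<chi>_def)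
  have \<chi>_mem [simp]: "\<chi> u \<in> A" for u by (simp add: \<chi>_def)
  have \<chi>_xpow: "\<chi> (xpow \<beta>) = (if \<beta> = sigma_total then C c else 0)" for \<beta>
    by (auto simp: \<chi>_def xpow_def lookup_single when_def)
  have br_\<chi>: "br u (\<chi> v) = 0" "br (\<chi> v) u = 0" for u v by (simp_all add: \<chi>_def)
  define \<psi> where "\<psi> u = u + \<chi> u" for u
  define \<phi> where "\<phi> u = u - \<chi> u" for u
  have inv: "\<psi> (\<phi> u) = u" "\<phi> (\<psi> u) = u" for u
    by (simp_all add: \<psi>_def \<phi>_def \<chi>_add \<chi>_diff \<chi>_\<chi>)
  have \<phi>_bij: "bij_betw \<phi> A A" by (rule bij_betw_byWitness[of _ \<psi>]) (auto simp: inv, auto simp: \<psi>_def \<phi>_def)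
  have \<psi>_bij: "bij_betw \<psi> A A" by (rule bij_betw_byWitness[of _ \<phi>]) (auto simp: inv, auto simp: \<psi>_def \<phi>_def)
  have \<phi>_inv: "inv_into A \<phi> x = \<psi> x" if "x \<in> A" for x
    using that inv \<psi>_bij bij_betw_imp_inj_on[OF \<phi>_bij] by (metis bij_betwE inv_into_f_f)
  define m' where "m' u v = inv_into A \<phi> (m (\<phi> u) (\<phi> v))" for u v
  have "second_product A br C m'"
    unfolding m'_def
  proof (rule second_product_pullback[OF poisson_subring_axioms assms \<phi>_bij, where \<kappa> = 1])
    show "\<phi> 1 = 1" using \<chi>_C[of 1] by (simp add: \<phi>_def)
    show "\<phi> (br u v) = C 1 * br (\<phi> u) (\<phi> v)" if "u \<in> A" "v \<in> A" for u v
      using \<chi>_br[OF that] br_skew[of "u - \<chi> u" v] br_skew[of u v] br_\<chi>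
      by (simp add: \<phi>_def br_diff_right)
  qed (simp_all add: \<phi>_def \<chi>_add \<chi>_scale right_diff_distrib add_diff_add)
  then interpret M': second_product A br C m' .
  interpret M': group_algebra_second_product l \<Gamma> m' by unfold_locales
  have m'_eq: "m' u v = \<psi> (m (\<phi> u) (\<phi> v))" if "u \<in> A" "v \<in> A" for u v
    using that by (simp add: m'_def \<phi>_inv \<phi>_def)
  have "M'.T (xpow \<alpha>) (xpow sigma_total) = 0"
  proof -
    have "m (xpow \<alpha>) (xpow sigma_total - C c) =
        m (xpow \<alpha>) (xpow sigma_total) - C c * xpow \<alpha>"
      using M.m_add_right[of "xpow \<alpha>" "xpow sigma_total" "C (- c)"] M.m_C_left[of "xpow \<alpha>" "- c"]
        M.m_comm[of "xpow \<alpha>" "C (- c)"] mem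
      by (simp add: C_minus)
    also have "\<dots> = xpow (\<alpha> + sigma_total)" using c by (simp add: M.T_def xpow_mult algebra_simps)
    finally show ?thesis
      unfolding M'.T_def using mem \<alpha>0 \<alpha>\<sigma> by (simp add: m'_eq \<phi>_def \<psi>_def \<chi>_xpow xpow_mult)
  qed
  then have M'_mult: "m' u v = u * v" if "u \<in> A" "v \<in> A" for u v
    using M'.T_eq_0_if_normalised[OF p \<alpha>] that by (simp add: M'.T_def)
  show ?thesis
  proof (rule that[OF \<psi>_bij])
    show "\<psi> (m u v) = \<psi> u * \<psi> v" if "u \<in> A" "v \<in> A" for u v
      using M'_mult[of "\<psi> u" "\<psi> v"] m'_eq[of "\<psi> u" "\<psi> v"] that inv by (simp add: \<psi>_def)
    show "\<psi> (br u v) = br (\<psi> u) (\<psi> v)" if "u \<in> A" "v \<in> A" for u v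
      using \<chi>_br[OF that] by (simp add: \<psi>_def br_add_right br_add_left br_\<chi>)
  qed (simp_all add: \<psi>_def \<chi>_add \<chi>_scale distrib_left add_ac)
qed

end

section \<open>Rescaling the bracket by an automorphism\<close>

definition twist :: "('k \<Rightarrow> 'a) \<Rightarrow> ('k \<Rightarrow>\<^sub>0 'a::field) \<Rightarrow> ('k \<Rightarrow>\<^sub>0 'a)" where
  "twist X = Poly_Mapping.mapp (\<lambda>k c. X k * c)"

lemma lookup_twist: "Poly_Mapping.lookup (twist X u) k = X k * Poly_Mapping.lookup u k"
  by (simp add: twist_def lookup_mapp when_def in_keys_iff)

lemma twist_single: "twist X (Poly_Mapping.single k c) = Poly_Mapping.single k (X k * c)"
  by (rule poly_mapping_eqI) (auto simp: lookup_twist lookup_single when_def)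

lemma twist_add: "twist X (u + v) = twist X u + twist X v"
  by (rule poly_mapping_eqI) (simp add: lookup_twist lookup_add distrib_left)

lemma twist_diff: "twist X (u - v) = twist X u - twist X v"
  by (rule poly_mapping_eqI) (simp add: lookup_twist lookup_minus right_diff_distrib)

lemma twist_0 [simp]: "twist X 0 = 0"
  by (rule poly_mapping_eqI) (simp add: lookup_twist)

lemma twist_sum: "twist X (sum f S) = (\<Sum>x\<in>S. twist X (f x))"
  by (induction S rule: infinite_finite_induct) (simp_all add: twist_add)

lemma twist_mult:
  fixes u v :: "'k::comm_monoid_add \<Rightarrow>\<^sub>0 'a::field"
  assumes "\<And>k k'. X (k + k') = X k * X k'"
  shows "twist X (u * v) = twist X u * twist X v"
proof -
  have *: "twist X (Poly_Mapping.single k c * v) = twist X (Poly_Mapping.single k c) * twist X v" for k c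
  proof -
    have "Poly_Mapping.keys v \<subseteq> UNIV" by simp
    then show ?thesis
    proof (induction v rule: keys_induct)
      case (single k c)
      show ?case by (simp add: mult_single twist_single assms ac_simps)
    next
      case (add f g)
      then show ?case by (simp add: distrib_left twist_add)
    qed
  qed
  have "Poly_Mapping.keys u \<subseteq> UNIV" by simp
  then show ?thesis by (induction u rule: keys_induct) (simp_all add: * distrib_right twist_add)
qed

lemma twist_inverse: "(\<And>k. X k \<noteq> 0) \<Longrightarrow> twist (\<lambda>k. inverse (X k)) (twist X u) = u"
  by (rule poly_mapping_eqI) (simp add: lookup_twist)

lemma keys_twist: "Poly_Mapping.keys (twist X u) \<subseteq> Poly_Mapping.keys u"
  by (auto simp: in_keys_iff lookup_twist)

context hamiltonian
begin

text \<open>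
  The weight of \<open>x\<^sup>\<alpha> t\<^sup>i\<close>: every term of the bracket contains either a factor \<open>x\<^bsup>\<sigma>\<^sub>p\<^esup>\<close>, of weight
  \<open>e 1\<close> (blocks 1 to 4), or a derivative with respect to a variable \<open>t\<close> of weight \<open>1 / e 1\<close>
  (blocks 5 to 7).
\<close>
definition weight :: "('a \<Rightarrow> 'a) \<Rightarrow> 'a vec \<times> mindex \<Rightarrow> 'a" where
  "weight e = (\<lambda>(\<alpha>, i). e (\<Sum>p\<in>{p \<in> {1..n}. block l p \<le> 4}. Poly_Mapping.lookup \<alpha> p) *
    inverse (e 1) ^ (\<Sum>p\<in>{p \<in> {1..n}. 5 \<le> block l p}. Poly_Mapping.lookup i (p + n)))"

context
  fixes e :: "'a \<Rightarrow> 'a"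
  assumes e_add: "\<And>x y. e (x + y) = e x * e y" and e_0: "e 0 = 1"
begin

lemma e_nonzero: "e x \<noteq> 0"
  using e_add[of x "- x"] e_0 by auto

lemma weight_add: "weight e (k + k') = weight e k * weight e k'"
  by (cases k, cases k') (simp add: weight_def lookup_add sum.distrib e_add power_add ac_simps)

lemma weight_nonzero: "weight e k \<noteq> 0"
  by (cases k) (simp add: weight_def e_nonzero)

lemma weight_0: "weight e 0 = 1"
  by (simp add: weight_def e_0 zero_prod_def)

lemma twist_C_mult: "twist (weight e) (C c * u) = C c * twist (weight e) u"
  using twist_mult[of "weight e" "C c" u] weight_add by (simp add: twist_single weight_0)

lemma weight_lower:
  assumes "Poly_Mapping.lookup i q \<noteq> 0"
  shows "weight e (\<alpha>, i - Poly_Mapping.single q 1) * weight e (0, Poly_Mapping.single q 1) = weight e (\<alpha>, i)"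
proof -
  have "i - Poly_Mapping.single q 1 + Poly_Mapping.single q 1 = i"
    using assms by (intro poly_mapping_eqI) (auto simp: lookup_add lookup_minus lookup_single when_def)
  then show ?thesis by (simp flip: weight_add)
qed

lemma weight_tvar:
  assumes "1 \<le> p" "p \<le> n"
  shows "weight e (0, Poly_Mapping.single p 1) = 1"
    and "weight e (0, Poly_Mapping.single (p + n) 1) = (if 5 \<le> block l p then inverse (e 1) else 1)"
proof -
  have "(\<Sum>q\<in>{q \<in> {1..n}. 5 \<le> block l q}. Poly_Mapping.lookup (Poly_Mapping.single p (1::nat)) (q + n)) = 0"
    using assms by (intro sum.neutral) (auto simp: lookup_single when_def)
  then show "weight e (0, Poly_Mapping.single p 1) = 1" by (simp add: weight_def e_0)
  have "(\<Sum>q\<in>{q \<in> {1..n}. 5 \<le> block l q}. Poly_Mapping.lookup (Poly_Mapping.single (p + n) (1::nat)) (q + n)) =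
      (\<Sum>q\<in>{q \<in> {1..n}. 5 \<le> block l q}. if q = p then 1 else 0)"
    by (intro sum.cong) (auto simp: lookup_single when_def)
  also have "\<dots> = (if 5 \<le> block l p then 1 else 0)" using assms by simp
  finally show "weight e (0, Poly_Mapping.single (p + n) 1) = (if 5 \<le> block l p then inverse (e 1) else 1)"
    by (simp add: weight_def e_0)
qed

lemma weight_sigma:
  assumes "1 \<le> p" "p \<le> n"
  shows "weight e (sigma l p, 0) = (if block l p \<le> 4 then e 1 else 1)"
proof -
  have "Poly_Mapping.lookup (sigma l p :: 'a vec) q = (if q = p \<and> block l p \<le> 4 then 1 else 0)"
    if "1 \<le> q" "q \<le> n" for q
  proof -
    have "block l p \<in> {1, 2, 3, 4} \<longleftrightarrow> block l p \<le> 4" using block_range[OF assms] by auto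
    then show ?thesis using that assms by (auto simp: sigma_eq lookup_add lookup_single when_def)
  qed
  then have "(\<Sum>q\<in>{q \<in> {1..n}. block l q \<le> 4}. Poly_Mapping.lookup (sigma l p :: 'a vec) q) =
      (\<Sum>q\<in>{q \<in> {1..n}. block l q \<le> 4}. if q = p then 1 else 0)"
    by (intro sum.cong) auto
  also have "\<dots> = (if block l p \<le> 4 then 1 else 0)" using assms by simp
  finally show ?thesis by (simp add: weight_def e_0)
qed

lemma twist_d_full:
  assumes "weight e (0, Poly_Mapping.single q 1) = 1"
  shows "twist (weight e) (d_full q u) = d_full q (twist (weight e) u)"
proof -
  have w: "weight e (\<alpha>, i - Poly_Mapping.single q 1) * (c * of_nat (Poly_Mapping.lookup i q)) =
      weight e (\<alpha>, i) * c * of_nat (Poly_Mapping.lookup i q)" for \<alpha> i c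
    using weight_lower[of i q \<alpha>] assms by (cases "Poly_Mapping.lookup i q = 0") simp_all
  have "Poly_Mapping.keys u \<subseteq> UNIV" by simp
  then show ?thesis
  proof (induction u rule: keys_induct)
    case (single k c)
    then show ?case
      by (cases k) (simp only: d_full_single twist_add twist_single w mult.assoc)
  qed (simp add: d_full_add twist_add)
qed

lemma twist_d_full_bar:
  assumes p: "1 \<le> p" "p \<le> n" "5 \<le> block l p" and u: "u \<in> A"
  shows "twist (weight e) (d_full (p + n) u) = C (e 1) * d_full (p + n) (twist (weight e) u)"
  using u
proof (induction u rule: A_induct)
  case (single \<alpha> i c)
  have 0: "Poly_Mapping.lookup \<alpha> (p + n) = 0" using \<Gamma>_lookup_bar single p by blast
  have "weight e (\<alpha>, i - Poly_Mapping.single (p + n) 1) * (c * of_nat (Poly_Mapping.lookup i (p + n))) =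
      e 1 * (weight e (\<alpha>, i) * c * of_nat (Poly_Mapping.lookup i (p + n)))"
  proof (cases "Poly_Mapping.lookup i (p + n) = 0")
    case False
    have "weight e (\<alpha>, i) = weight e (\<alpha>, i - Poly_Mapping.single (p + n) 1) * inverse (e 1)"
      using weight_lower[OF False, of \<alpha>] weight_tvar(2)[OF p(1,2)] p(3) by simp
    then show ?thesis using e_nonzero[of 1] by (simp add: field_simps)
  qed simp
  then show ?case
    by (simp only: d_full_single twist_add twist_single 0 mult_zero_right single_zero add_0
        mult_single)
next
  case (add f g)
  then show ?case by (simp add: d_full_add twist_add distrib_left)
qed

lemma twist_br:
  assumes u: "u \<in> A" and v: "v \<in> A"
  shows "twist (weight e) (br u v) = C (e 1) * br (twist (weight e) u) (twist (weight e) v)"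
  unfolding br_eq twist_sum sum_distrib_left
proof (intro sum.cong refl)
  fix p assume "p \<in> {1..n}"
  then have p: "1 \<le> p" "p \<le> n" by auto
  let ?s = "twist (weight e)"
  note mult = twist_mult[of "weight e", OF weight_add]
  have x: "?s (xpow (sigma l p)) = C (if block l p \<le> 4 then e 1 else 1) * xpow (sigma l p)"
    by (simp add: xpow_def twist_single weight_sigma[OF p] mult_single)
  have d: "?s (d_full p w) = d_full p (?s w)" for w
    using twist_d_full weight_tvar(1)[OF p] by blast
  have d': "?s (d_full (p + n) w) = C (if block l p \<le> 4 then 1 else e 1) * d_full (p + n) (?s w)" if "w \<in> A" for w
    using twist_d_full[of "p + n" w] twist_d_full_bar[OF p _ that] weight_tvar(2)[OF p] by auto
  show "?s (xpow (sigma l p) * (d_full p u * d_full (p + n) v - d_full (p + n) u * d_full p v)) =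
      C (e 1) * (xpow (sigma l p) * (d_full p (?s u) * d_full (p + n) (?s v) - d_full (p + n) (?s u) * d_full p (?s v)))"
    by (simp add: mult twist_diff x d d'[OF u] d'[OF v] algebra_simps)
qed

lemma twist_bij: "bij_betw (twist (weight e)) A A"
proof (rule bij_betw_byWitness[of _ "twist (\<lambda>k. inverse (weight e k))"])
  have "twist X u \<in> A" if "u \<in> A" for X u
    using keys_twist[of X u] that by (auto simp: ham_carrier_def)
  then show "twist (weight e) ` A \<subseteq> A" "twist (\<lambda>k. inverse (weight e k)) ` A \<subseteq> A" by auto
  show "\<forall>u\<in>A. twist (weight e) (twist (\<lambda>k. inverse (weight e k)) u) = u"
    using twist_inverse[of "\<lambda>k. inverse (weight e k)"] weight_nonzero by simp
qed (simp add: twist_inverse weight_nonzero)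

end

end

section \<open>Lie isomorphisms and Poisson isomorphisms\<close>

lemma (in hamiltonian) second_product_isomorphic:
  assumes "second_product A br C m"
  obtains \<psi> where "bij_betw \<psi> A A" "\<And>u v. \<psi> (u + v) = \<psi> u + \<psi> v" "\<And>c u. \<psi> (C c * u) = C c * \<psi> u"
    "\<And>u v. u \<in> A \<Longrightarrow> v \<in> A \<Longrightarrow> \<psi> (br u v) = br (\<psi> u) (\<psi> v)"
    "\<And>u v. u \<in> A \<Longrightarrow> v \<in> A \<Longrightarrow> \<psi> (m u v) = \<psi> u * \<psi> v"
proof (cases "tvars = {}")
  case True
  then interpret hamiltonian_group_algebra by unfold_locales
  show ?thesis by (rule group_algebra_second_product_isomorphic[OF assms], rule that)
next
  case False
  show ?thesis
    by (rule that[of id]) (simp_all add: second_product_trivial_if_tvars[OF assms False])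
qed

lemma lie_isomorphic_imp_poisson_isomorphic:
  fixes l l' :: "nat \<Rightarrow> nat"
    and \<Gamma> \<Gamma>' :: "'a::{alg_closed_field, field_char_0} vec set"
  assumes \<Gamma>: "hamiltonian_datum l \<Gamma>" and \<Gamma>': "hamiltonian_datum l' \<Gamma>'"
    and iso: "lie_isomorphic l \<Gamma> l' \<Gamma>'"
  shows "poisson_isomorphic l \<Gamma> l' \<Gamma>'"
proof -
  interpret H: hamiltonian l \<Gamma> by unfold_locales fact
  interpret H': hamiltonian l' \<Gamma>' by unfold_locales fact
  obtain f where f_bij: "bij_betw f H.A H'.A"
    and f_add: "\<And>u v. u \<in> H.A \<Longrightarrow> v \<in> H.A \<Longrightarrow> f (u + v) = f u + f v"
    and f_scale: "\<And>c u. u \<in> H.A \<Longrightarrow> f (H.C c * u) = H.C c * f u"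
    and f_br: "\<And>u v. u \<in> H.A \<Longrightarrow> v \<in> H.A \<Longrightarrow> f (H.br u v) = H'.br (f u) (f v)"
    using iso unfolding lie_isomorphic_def linear_bij_def preserves_op_def scale_eq_mult by blast
  have f_mem [simp]: "f u \<in> H'.A" if "u \<in> H.A" for u using that f_bij by (rule bij_betwE[rule_format, rotated])
  have f_0: "f 0 = 0" using f_add[of 0 0] by simp
  \<comment> \<open>the preimage of the unit is central, hence a scalar\<close>
  obtain z where z: "z \<in> H.A" "f z = 1"
    using f_bij H'.one_closed unfolding bij_betw_def by (metis image_iff)
  have "H.br v z = 0" if "v \<in> H.A" for v
  proof -
    have "f (H.br v z) = f 0" using f_br[OF that z(1)] z f_0 by simp
    then show ?thesis using f_bij that z unfolding bij_betw_def by (auto dest: inj_onD)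
  qed
  then obtain k where k: "z = H.C k" using H.central_imp_scalar[OF z(1)] by blast
  have k0: "k \<noteq> 0" using z f_0 by (auto simp: k)
  define \<theta> where "\<theta> u = H.C k * f u" for u
  have \<theta>_1: "\<theta> 1 = 1" using f_scale[of 1 k] z by (simp add: \<theta>_def k)
  have Ck: "H.C k * (H.C (inverse k) * u) = u" "H.C (inverse k) * (H.C k * u) = u" for u :: "'a alg"
    using k0 by (simp_all add: mult_single flip: mult.assoc)
  have "bij_betw (\<lambda>u. H.C k * u) H'.A H'.A"
    by (rule bij_betw_byWitness[of _ "\<lambda>u. H.C (inverse k) * u"]) (auto simp: Ck)
  then have \<theta>_bij: "bij_betw \<theta> H.A H'.A"
    using bij_betw_trans[OF f_bij] by (simp add: \<theta>_def[abs_def] comp_def)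
  have \<theta>_add: "\<theta> (u + v) = \<theta> u + \<theta> v" if "u \<in> H.A" "v \<in> H.A" for u v
    using that by (simp add: \<theta>_def f_add distrib_left)
  have \<theta>_scale: "\<theta> (H.C c * u) = H.C c * \<theta> u" if "u \<in> H.A" for c u
    using that by (simp add: \<theta>_def f_scale mult.left_commute)
  have \<theta>_br: "\<theta> (H.br u v) = H.C (inverse k) * H'.br (\<theta> u) (\<theta> v)" if "u \<in> H.A" "v \<in> H.A" for u v
    using that by (simp add: \<theta>_def f_br H'.br_scale_left H'.br_scale_right Ck)
  \<comment> \<open>the product of the target, seen as a second product on the source\<close>
  define m where "m u v = inv_into H.A \<theta> (\<theta> u * \<theta> v)" for u v
  have m: "second_product H.A H.br H.C m"
    unfolding m_def
    by (rule second_product_pullback[OF H.poisson_subring_axioms H'.second_product_mult \<theta>_bij])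
      (simp_all add: \<theta>_add \<theta>_scale \<theta>_1 \<theta>_br)
  have \<theta>_m: "\<theta> (m u v) = \<theta> u * \<theta> v" if "u \<in> H.A" "v \<in> H.A" for u v
    using that \<theta>_bij unfolding m_def
    by (metis H'.mult_closed bij_betw_inv_into_right bij_betwE)
  obtain \<psi> where \<psi>_bij: "bij_betw \<psi> H.A H.A" and \<psi>_add: "\<And>u v. \<psi> (u + v) = \<psi> u + \<psi> v"
    and \<psi>_scale: "\<And>c u. \<psi> (H.C c * u) = H.C c * \<psi> u"
    and \<psi>_br: "\<And>u v. u \<in> H.A \<Longrightarrow> v \<in> H.A \<Longrightarrow> \<psi> (H.br u v) = H.br (\<psi> u) (\<psi> v)"
    and \<psi>_m: "\<And>u v. u \<in> H.A \<Longrightarrow> v \<in> H.A \<Longrightarrow> \<psi> (m u v) = \<psi> u * \<psi> v"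
    by (rule H.second_product_isomorphic[OF m], rule that)
  obtain e :: "'a \<Rightarrow> 'a" where e: "e 1 = k" "\<And>x y. e (x + y) = e x * e y" "e 0 = 1"
    using additive_character[OF k0] by blast
  \<comment> \<open>\<open>s\<close> cancels the factor \<open>inverse k\<close> by which \<open>\<theta>\<close> fails to respect the brackets\<close>
  define s where "s = twist (H.weight e)"
  have s_bij: "bij_betw s H.A H.A" unfolding s_def by (rule H.twist_bij[OF e(2,3)])
  define \<phi> where "\<phi> = inv_into H.A \<psi>"
  have \<phi>_bij: "bij_betw \<phi> H.A H.A" unfolding \<phi>_def by (rule bij_betw_inv_into[OF \<psi>_bij])
  have mem: "s u \<in> H.A" "\<phi> u \<in> H.A" if "u \<in> H.A" for u
    using that s_bij \<phi>_bij by (auto dest: bij_betwE)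
  have \<psi>\<phi>: "\<psi> (\<phi> u) = u" if "u \<in> H.A" for u
    unfolding \<phi>_def by (rule bij_betw_inv_into_right[OF \<psi>_bij that])
  have \<phi>\<psi>: "\<phi> (\<psi> u) = u" if "u \<in> H.A" for u
    unfolding \<phi>_def by (rule bij_betw_inv_into_left[OF \<psi>_bij that])
  have \<phi>_add: "\<phi> (u + v) = \<phi> u + \<phi> v" if "u \<in> H.A" "v \<in> H.A" for u v
    using \<phi>\<psi>[of "\<phi> u + \<phi> v"] that mem by (simp add: \<psi>_add \<psi>\<phi>)
  have \<phi>_scale: "\<phi> (H.C c * u) = H.C c * \<phi> u" if "u \<in> H.A" for c u
    using \<phi>\<psi>[of "H.C c * \<phi> u"] that mem by (simp add: \<psi>_scale \<psi>\<phi>)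
  have \<phi>_br: "\<phi> (H.br u v) = H.br (\<phi> u) (\<phi> v)" if "u \<in> H.A" "v \<in> H.A" for u v
    using \<phi>\<psi>[of "H.br (\<phi> u) (\<phi> v)"] that mem by (simp add: \<psi>_br \<psi>\<phi>)
  have \<phi>_mult: "\<phi> (u * v) = m (\<phi> u) (\<phi> v)" if "u \<in> H.A" "v \<in> H.A" for u v
    using \<phi>\<psi>[of "m (\<phi> u) (\<phi> v)"] that mem second_product.m_closed[OF m] by (simp add: \<psi>_m \<psi>\<phi>)
  define F where "F = \<theta> \<circ> (\<phi> \<circ> s)"
  have F_bij: "bij_betw F H.A H'.A"
    unfolding F_def by (intro bij_betw_trans[OF _ \<theta>_bij] bij_betw_trans[OF s_bij \<phi>_bij])
  have F_add: "F (u + v) = F u + F v" if "u \<in> H.A" "v \<in> H.A" for u v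
  proof -
    have "s (u + v) = s u + s v" by (simp add: s_def twist_add)
    then show ?thesis using that mem by (simp add: F_def \<phi>_add \<theta>_add)
  qed
  have F_scale: "F (H.C c * u) = H.C c * F u" if "u \<in> H.A" for c u
  proof -
    have "s (H.C c * u) = H.C c * s u" unfolding s_def by (rule H.twist_C_mult[OF e(2,3)])
    then show ?thesis using that mem by (simp add: F_def \<phi>_scale \<theta>_scale)
  qed
  have F_mult: "F (u * v) = F u * F v" if "u \<in> H.A" "v \<in> H.A" for u v
  proof -
    have "s (u * v) = s u * s v" unfolding s_def by (rule twist_mult) (rule H.weight_add[OF e(2,3)])
    then show ?thesis using that mem by (simp add: F_def \<phi>_mult \<theta>_m)
  qed
  have F_br: "F (H.br u v) = H'.br (F u) (F v)" if "u \<in> H.A" "v \<in> H.A" for u v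
  proof -
    have "s (H.br u v) = H.C k * H.br (s u) (s v)"
      unfolding s_def using H.twist_br[OF e(2,3) that] e(1) by simp
    then show ?thesis using that mem by (simp add: F_def \<phi>_scale \<phi>_br \<theta>_scale \<theta>_br Ck)
  qed
  have "linear_bij F H.A H'.A"
    unfolding linear_bij_def scale_eq_mult by (intro conjI ballI allI F_bij F_add F_scale)
  moreover have "preserves_op F H.A (*) (*)" "preserves_op F H.A H.br H'.br"
    unfolding preserves_op_def by (intro ballI F_mult F_br; assumption)+
  ultimately show ?thesis unfolding poisson_isomorphic_def by (intro exI conjI)
qed

theorem mainTheorem1:
  fixes l l' :: "nat \<Rightarrow> nat"
    and \<Gamma> \<Gamma>' :: "'a::{alg_closed_field, field_char_0} vec set"
  assumes "hamiltonian_datum l \<Gamma>"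
    and "hamiltonian_datum l' \<Gamma>'"
  shows "lie_isomorphic l \<Gamma> l' \<Gamma>' \<longleftrightarrow> poisson_isomorphic l \<Gamma> l' \<Gamma>'"
proof
  show "lie_isomorphic l \<Gamma> l' \<Gamma>' \<Longrightarrow> poisson_isomorphic l \<Gamma> l' \<Gamma>'"
    using lie_isomorphic_imp_poisson_isomorphic[OF assms] .
  show "poisson_isomorphic l \<Gamma> l' \<Gamma>' \<Longrightarrow> lie_isomorphic l \<Gamma> l' \<Gamma>'"
    unfolding lie_isomorphic_def poisson_isomorphic_def by blast
qed

end
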